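(* Let $(\Omega,\mathscr F,\mathbb P)=(\mathcal A^{\mathbb N},\mathcal F^{\mathbb N},p^{\mathbb N})$ with $\tau$ the shift, let $\Psi:\Omega\to\mathbb Z$ and $Z:\Omega\to\mathbb Z$ be one-step random variables with $\mathbb E[Z]=0$ and $0<\mathbb E[Z^2]<\infty$, and let $T:I\to I$ be a homeomorphism of $I=[0,1]$ that fixes only the endpoints. Let $\{p_k\}_{k\in\mathbb Z}\subset(0,1)$ be strictly increasing with $\lim_{k\to-\infty}p_k=0$ and $\lim_{k\to+\infty}p_k=1$, and put $I_k=[p_k,p_{k+1})$, $d_k=p_{k+1}-p_k$. Let $F_{T^\Psi,Z}:\Omega\times I\to\Omega\times I$, $F_{T^\Psi,Z}(\omega,x)=(\tau(\omega),f_{\omega_0}(x))$, where for $x\in I_k$ $$f_{\omega_0}(x)=p_{k+Z(\omega_0)}+d_{k+Z(\omega_0)}\cdot T^{\Psi(\omega_0)}(u)\in I_{k+Z(\omega_0)},\qquad u=\frac{x-p_k}{d_k},$$ and $f_{\omega_0}(0)=0$, $f_{\omega_0}(1)=1$. Then $F_{T^\Psi,Z}$ has historical behavior for $(\mathbb P\times\mathrm{Leb})$-a.e. point. Moreover, for every $x\in(0,1)$, $$\mathcal L(\omega,x)=\{\lambda\delta_0+(1-\lambda)\delta_1:\lambda\in[0,1]\}\quad\text{for }\mathbb P\text{-a.e. }\omega\in\Omega.$$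
   Context: $\mathcal A$ is an at most countable alphabet with discrete $\sigma$-algebra $\mathcal F$, and the marginal $p$ of $\mathbb P$ is a probability measure on $\mathcal A$ with full support. A random variable $\Psi$ on $\Omega$ is one-step if $\Psi(\omega)=\Psi(\omega_0)$ depends only on the zero coordinate of $\omega=(\omega_i)_{i\ge0}$. $f^0_\omega=\mathrm{id}$ and $f^n_\omega=f_{\omega_{n-1}}\circ\dots\circ f_{\omega_0}$ for $n\ge1$. $\mathrm{Leb}$ is Lebesgue measure on $I$. Historical behavior for $(\mathbb P\times\mathrm{Leb})$-a.e. point: for $(\mathbb P\times\mathrm{Leb})$-a.e. $(\omega,x)$ there is a continuous $\varphi:I\to\mathbb R$ such that $\lim_{n\to\infty}\frac1n\sum_{j=0}^{n-1}\varphi(f^j_\omega(x))$ does not exist. $\mathcal L(\omega,x)$ is the set of weak$^*$ accumulation points of $\frac1n\sum_{j=0}^{n-1}\delta_{f^j_\omega(x)}$, $n\ge1$. *)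

theory Defs
  imports "HOL-Probability.Probability"
begin

section \<open>One-step random iterations on the unit interval\<close>

text \<open>
  A probability measure on an at most countable discrete alphabet is a \<open>pmf\<close> on a countable type;
  full support is \<open>set_pmf p = UNIV\<close>.
\<close>

definition bernoulli_measure :: "'a pmf \<Rightarrow> (nat \<Rightarrow> 'a) measure" where
  "bernoulli_measure p = Pi\<^sub>M UNIV (\<lambda>_. measure_pmf p)"

definition shift :: "(nat \<Rightarrow> 'a) \<Rightarrow> nat \<Rightarrow> 'a" where
  "shift \<omega> = (\<lambda>i. \<omega> (Suc i))"

definition skew_product ::
    "('a \<Rightarrow> real \<Rightarrow> real) \<Rightarrow> (nat \<Rightarrow> 'a) \<times> real \<Rightarrow> (nat \<Rightarrow> 'a) \<times> real" where
  "skew_product f = (\<lambda>(\<omega>, x). (shift \<omega>, f (\<omega> 0) x))"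

primrec fiber_iter :: "('a \<Rightarrow> real \<Rightarrow> real) \<Rightarrow> (nat \<Rightarrow> 'a) \<Rightarrow> nat \<Rightarrow> real \<Rightarrow> real" where
  "fiber_iter f \<omega> 0 = id"
| "fiber_iter f \<omega> (Suc n) = f (\<omega> n) \<circ> fiber_iter f \<omega> n"

lemma skew_product_iter:
  "(skew_product f ^^ n) (\<omega>, x) = ((shift ^^ n) \<omega>, fiber_iter f \<omega> n x)"
proof -
  have shift: "(shift ^^ n) \<omega> i = \<omega> (n + i)" for n i
    by (induction n arbitrary: i) (simp_all add: shift_def)
  show ?thesis
    by (induction n) (simp_all add: skew_product_def shift[of _ 0, simplified])
qed

section \<open>Historical behavior and limit measures\<close>

definition unit_borel :: "real measure" where
  "unit_borel = restrict_space borel {0..1}"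

text \<open>Lebesgue measure on Borel sets; completing it would not change the almost-everywhere quantifier.\<close>

definition unit_lebesgue :: "real measure" where
  "unit_lebesgue = restrict_space lborel {0..1}"

text \<open>
  The following is a property of the skew product with fiber maps \<open>f\<close>: the iterates \<open>fiber_iter f \<omega> j x\<close>
  are the second components of its orbit, see \<open>skew_product_iter\<close>.
\<close>

definition historical_behavior_ae :: "'a pmf \<Rightarrow> ('a \<Rightarrow> real \<Rightarrow> real) \<Rightarrow> bool" where
  "historical_behavior_ae p f \<longleftrightarrow>
     (AE (\<omega>, x) in bernoulli_measure p \<Otimes>\<^sub>M unit_lebesgue.
        \<exists>\<phi>::real \<Rightarrow> real. continuous_on {0..1} \<phi> \<and>
          \<not> convergent (\<lambda>n. (1 / real n) * (\<Sum>j<n. \<phi> (fiber_iter f \<omega> j x))))"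

text \<open>The weak* topology on the Borel probability measures on the unit interval.\<close>

definition unit_prob_measures :: "real measure set" where
  "unit_prob_measures = {\<mu>. prob_space \<mu> \<and> sets \<mu> = sets unit_borel}"

definition weak_star_topology :: "real measure topology" where
  "weak_star_topology = topology_generated_by
     {{\<mu> \<in> unit_prob_measures. (\<integral>x. \<phi> x \<partial>\<mu>) \<in> U} | \<phi> U.
        continuous_on {0..1} (\<phi> :: real \<Rightarrow> real) \<and> open (U :: real set)}"

lemma topspace_weak_star_topology: "topspace weak_star_topology = unit_prob_measures"
proof -
  have "unit_prob_measures = {\<mu> \<in> unit_prob_measures. (\<integral>x. 0 \<partial>\<mu>) \<in> (UNIV :: real set)}"
    by simp
  then have "unit_prob_measures \<in> {{\<mu> \<in> unit_prob_measures. (\<integral>x. \<phi> x \<partial>\<mu>) \<in> U} | \<phi> U.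
        continuous_on {0..1} (\<phi> :: real \<Rightarrow> real) \<and> open (U :: real set)}"
    by (intro CollectI exI[of _ "\<lambda>_. 0"] exI[of _ UNIV]) simp
  then show ?thesis
    unfolding weak_star_topology_def topology_generated_by_topspace by blast
qed

definition empirical_measure :: "('a \<Rightarrow> real \<Rightarrow> real) \<Rightarrow> (nat \<Rightarrow> 'a) \<Rightarrow> real \<Rightarrow> nat \<Rightarrow> real measure" where
  "empirical_measure f \<omega> x n = measure_of (space unit_borel) (sets unit_borel)
     (\<lambda>A. ennreal (1 / real n) * (\<Sum>j<n. emeasure (return unit_borel (fiber_iter f \<omega> j x)) A))"

definition convex_combination :: "real \<Rightarrow> real measure \<Rightarrow> real measure \<Rightarrow> real measure" where
  "convex_combination l \<mu> \<nu> = measure_of (space unit_borel) (sets unit_borel)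
     (\<lambda>A. ennreal l * emeasure \<mu> A + ennreal (1 - l) * emeasure \<nu> A)"

text \<open>Accumulation points are those of the sequence (cluster points), not of its range.\<close>

definition limit_measures :: "('a \<Rightarrow> real \<Rightarrow> real) \<Rightarrow> (nat \<Rightarrow> 'a) \<Rightarrow> real \<Rightarrow> real measure set" where
  "limit_measures f \<omega> x = {\<mu> \<in> topspace weak_star_topology.
     \<forall>U. openin weak_star_topology U \<and> \<mu> \<in> U \<longrightarrow>
       (\<exists>\<^sub>F n in sequentially. empirical_measure f \<omega> x n \<in> U)}"

text \<open>The set functions above are countably additive, so \<^const>\<open>measure_of\<close> does not collapse.\<close>

lemma emeasure_empirical_measure:
  assumes "A \<in> sets unit_borel"
  shows "emeasure (empirical_measure f \<omega> x n) A =
    ennreal (1 / real n) * (\<Sum>j<n. emeasure (return unit_borel (fiber_iter f \<omega> j x)) A)"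
proof (rule emeasure_measure_of[OF empirical_measure_def])
  show "sets unit_borel \<subseteq> Pow (space unit_borel)"
    by (rule sets.space_closed)
  show "A \<in> sets (empirical_measure f \<omega> x n)"
    using assms by (simp add: empirical_measure_def)
  show "positive (sets (empirical_measure f \<omega> x n))
     (\<lambda>A. ennreal (1 / real n) * (\<Sum>j<n. emeasure (return unit_borel (fiber_iter f \<omega> j x)) A))"
    by (simp add: positive_def)
  show "countably_additive (sets (empirical_measure f \<omega> x n))
     (\<lambda>A. ennreal (1 / real n) * (\<Sum>j<n. emeasure (return unit_borel (fiber_iter f \<omega> j x)) A))"
  proof (rule countably_additiveI)
    fix B :: "nat \<Rightarrow> real set"
    assume "range B \<subseteq> sets (empirical_measure f \<omega> x n)" and "disjoint_family B"
    then have "(\<Sum>i. emeasure (return unit_borel y) (B i)) = emeasure (return unit_borel y) (\<Union>i. B i)" for y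
      by (intro suminf_emeasure) (auto simp: empirical_measure_def)
    then show "(\<Sum>i. ennreal (1 / real n) * (\<Sum>j<n. emeasure (return unit_borel (fiber_iter f \<omega> j x)) (B i))) =
        ennreal (1 / real n) * (\<Sum>j<n. emeasure (return unit_borel (fiber_iter f \<omega> j x)) (\<Union>i. B i))"
      by (simp add: suminf_sum)
  qed
qed

lemma emeasure_convex_combination:
  assumes "sets \<mu> = sets unit_borel" "sets \<nu> = sets unit_borel" "A \<in> sets unit_borel"
  shows "emeasure (convex_combination l \<mu> \<nu>) A =
    ennreal l * emeasure \<mu> A + ennreal (1 - l) * emeasure \<nu> A"
proof (rule emeasure_measure_of[OF convex_combination_def])
  show "sets unit_borel \<subseteq> Pow (space unit_borel)"
    by (rule sets.space_closed)
  show "A \<in> sets (convex_combination l \<mu> \<nu>)"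
    using assms by (simp add: convex_combination_def)
  show "positive (sets (convex_combination l \<mu> \<nu>))
     (\<lambda>A. ennreal l * emeasure \<mu> A + ennreal (1 - l) * emeasure \<nu> A)"
    by (simp add: positive_def)
  show "countably_additive (sets (convex_combination l \<mu> \<nu>))
     (\<lambda>A. ennreal l * emeasure \<mu> A + ennreal (1 - l) * emeasure \<nu> A)"
  proof (rule countably_additiveI)
    fix B :: "nat \<Rightarrow> real set"
    assume B: "range B \<subseteq> sets (convex_combination l \<mu> \<nu>)" and "disjoint_family B"
    then have "(\<Sum>i. emeasure \<mu> (B i)) = emeasure \<mu> (\<Union>i. B i)"
      and "(\<Sum>i. emeasure \<nu> (B i)) = emeasure \<nu> (\<Union>i. B i)"
      by (intro suminf_emeasure; auto simp: convex_combination_def assms)+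
    then show "(\<Sum>i. ennreal l * emeasure \<mu> (B i) + ennreal (1 - l) * emeasure \<nu> (B i)) =
        ennreal l * emeasure \<mu> (\<Union>i. B i) + ennreal (1 - l) * emeasure \<nu> (\<Union>i. B i)"
      by (simp add: suminf_add[symmetric])
  qed
qed

section \<open>The fiber maps driven by a random walk on the intervals\<close>

text \<open>
  \<open>T\<close> is only meaningful on the unit interval, so negative powers use its inverse there.
\<close>

definition int_iterate :: "(real \<Rightarrow> real) \<Rightarrow> int \<Rightarrow> real \<Rightarrow> real" where
  "int_iterate T m = (if m \<ge> 0 then T ^^ nat m else inv_into {0..1} T ^^ nat (- m))"

definition interval_index :: "(int \<Rightarrow> real) \<Rightarrow> real \<Rightarrow> int" where
  "interval_index q x = (THE k. x \<in> {q k..<q (k + 1)})"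

text \<open>
  The endpoints are fixed by the last branch; it also gives an irrelevant value outside the unit
  interval.
\<close>

definition walk_fiber_map ::
    "(int \<Rightarrow> real) \<Rightarrow> (real \<Rightarrow> real) \<Rightarrow> ('a \<Rightarrow> int) \<Rightarrow> ('a \<Rightarrow> int) \<Rightarrow> 'a \<Rightarrow> real \<Rightarrow> real" where
  "walk_fiber_map q T \<psi> \<zeta> a x =
     (if 0 < x \<and> x < 1 then
        let d = (\<lambda>k. q (k + 1) - q k);
            k = interval_index q x;
            u = (x - q k) / d k
        in q (k + \<zeta> a) + d (k + \<zeta> a) * int_iterate T (\<psi> a) u
      else x)"

lemma interval_index_unique:
  fixes q :: "int \<Rightarrow> real"
  assumes q: "strict_mono q" "(q \<longlongrightarrow> 0) at_bot" "(q \<longlongrightarrow> 1) at_top" and x: "0 < x" "x < 1"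
  shows "\<exists>!k. x \<in> {q k..<q (k + 1)}"
proof -
  obtain a where a: "q a < x"
    using order_tendstoD(2)[OF q(2) x(1)] by (auto simp: eventually_at_bot_linorder)
  obtain b where b: "x < q b"
    using order_tendstoD(1)[OF q(3) x(2)] by (auto simp: eventually_at_top_linorder)
  have "a \<le> b"
    using a b q(1) by (meson less_trans linorder_not_le order.asym strict_mono_less)
  then have "\<exists>k. x \<in> {q k..<q (k + 1)}"
    using b
  proof (induction b rule: int_ge_induct)
    case base
    then show ?case using a by simp
  next
    case (step i)
    then show ?case by (cases "x < q i") (auto simp: not_less)
  qed
  moreover have "k = l" if "x \<in> {q k..<q (k + 1)}" "x \<in> {q l..<q (l + 1)}" for k l
  proof -
    have "q k < q (l + 1)" "q l < q (k + 1)"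
      using that by auto
    then show ?thesis
      using q(1) by (simp add: strict_mono_less)
  qed
  ultimately show ?thesis by blast
qed

end

theory Submission
  imports Defs
begin

text \<open>
  A fiber map sends the interval \<open>[q k, q (k + 1))\<close> into the interval with index \<open>k + \<zeta> a\<close>, whatever power
  of \<open>T\<close> is applied inside. So an orbit that starts in the interval with index \<open>k\<close> is, at time \<open>n\<close>, in
  the interval with index \<open>k + S n\<close>, where \<open>S\<close> is an integer random walk with centered steps of finite
  nonzero variance. Intervals with large positive index lie near 1, those with large negative index lie
  near 0. Everything is therefore decided by how the walk divides its time between the positive and the
  negative half line (\<open>fiber_iter_index\<close>, \<open>average_near_endpoints\<close>).

  The walk spends a vanishing fraction of its time in every bounded set. The function \<open>\<bar>s - y\<bar>\<close> is convex,
  so \<open>E \<bar>S n - y\<bar>\<close> never decreases, and it gains at least \<open>E \<bar>Z\<bar> * P (S n = y)\<close> in step \<open>n\<close>. Since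
  \<open>E \<bar>S n\<bar>\<close> is at most of order \<open>\<surd>n\<close>, the expected fraction of time spent at \<open>y\<close> up to time \<open>n\<close> is at
  most of order \<open>1 / \<surd>n\<close>. This is summable along fourth powers, and the number of visits is monotone in
  \<open>n\<close>, which gives almost sure convergence (\<open>AE_freq_visit\<close>). Consequently the empirical average of a
  continuous \<open>\<phi>\<close> differs from \<open>(1 - a n) * \<phi> 0 + a n * \<phi> 1\<close> by a null sequence, where \<open>a n\<close> is the
  fraction of times before \<open>n\<close> at which the walk is positive.

  It remains to see that almost surely every number in \<open>[0, 1]\<close> is a cluster point of \<open>a\<close>. Consecutive
  terms differ by at most \<open>1 / n\<close>, so it is enough that the upper limit is 1 and the lower limit is 0
  (\<open>freq_cluster_points\<close>); by symmetry only the upper limit matters. By the central limit theorem the walk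
  is above \<open>c * \<surd>n\<close> at time \<open>n\<close> with probability bounded away from 0, for any \<open>c\<close>. If \<open>c\<close> is large compared
  with \<open>K\<close>, then Chebyshev's inequality shows that with probability at least one half the walk undoes this
  lead at fewer than \<open>n\<close> of the next \<open>K * n\<close> times. The two events are independent, and on their
  intersection \<open>a\<close> is close to 1 at time \<open>(K + 1) * n\<close>. So the upper limit is close to 1 with positive
  probability (\<open>eventually_mostly_positive\<close>). Altering finitely many letters translates the later part of
  the walk, which does not change the upper limit because bounded sets are visited with frequency 0; hence
  a zero-one law turns positive probability into probability one (\<open>zero_one_law\<close>, \<open>AE_limsup_ge\<close>).
\<close>

section \<open>Asymptotic frequencies\<close>

definition freq :: "(nat \<Rightarrow> bool) \<Rightarrow> nat \<Rightarrow> real" where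
  "freq A n = (\<Sum>j<n. of_bool (A j)) / real n"

lemma freq_nonneg: "0 \<le> freq A n"
  by (simp add: freq_def sum_nonneg)

lemma sum_of_bool_le: "(\<Sum>j<n. of_bool (A j)) \<le> real n"
  using sum_mono[of "{..<n}" "\<lambda>j. of_bool (A j)" "\<lambda>_. 1::real"] by simp

lemma freq_le_1: "freq A n \<le> 1"
  using sum_of_bool_le[of A n] unfolding freq_def by (auto simp: divide_le_eq_1)

text \<open>
  The number of indices in \<open>A\<close> is monotone, so the frequency at \<open>n\<close> is controlled by the one at the next
  fourth power, which exceeds \<open>n\<close> at most by the factor \<open>2 ^ 4\<close>.
\<close>
lemma freq_tendsto_0_if_fourth_powers:
  assumes "(\<lambda>k. freq A (k ^ 4)) \<longlonglongrightarrow> 0"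
  shows "freq A \<longlonglongrightarrow> 0"
proof -
  define r where "r n = nat \<lfloor>root 4 (real n)\<rfloor>" for n
  have r: "real (r n) \<le> root 4 (real n)" "root 4 (real n) < real (r n) + 1" for n
    unfolding r_def by (auto simp: of_nat_nat)
  have lim: "filterlim r at_top sequentially"
    unfolding filterlim_at_top eventually_sequentially
  proof (intro allI exI impI)
    fix Z n :: nat assume "Z ^ 4 \<le> n"
    then have "real Z ^ 4 \<le> real n" by (simp only: of_nat_power[symmetric] of_nat_le_iff)
    then have "root 4 (real Z ^ 4) \<le> root 4 (real n)" by simp
    then have "real Z \<le> root 4 (real n)" by (simp add: real_root_power_cancel)
    then show "Z \<le> r n" unfolding r_def by linarith
  qed
  have "freq A n \<le> 16 * freq A (Suc (r n) ^ 4)" if n: "n \<ge> 1" for n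
  proof -
    have root1: "1 \<le> root 4 (real n)" using n by simp
    then have r1: "1 \<le> r n" unfolding r_def by linarith
    have le: "real (r n) ^ 4 \<le> real n"
      using power_mono[OF r(1)[of n], of 4] by simp
    have ge: "n \<le> Suc (r n) ^ 4"
    proof -
      have "real n = root 4 (real n) ^ 4" by simp
      also have "\<dots> \<le> (real (r n) + 1) ^ 4" 
        using r(2)[of n] by (intro power_mono) auto
      finally have "real n \<le> real (Suc (r n) ^ 4)" by (simp add: add.commute)
      then show ?thesis by (simp only: of_nat_le_iff)
    qed
    have four: "real (Suc (r n) ^ 4) \<le> 16 * real n"
    proof -
      have "real (Suc (r n) ^ 4) \<le> (2 * real (r n)) ^ 4"
        using r1 unfolding of_nat_power by (intro power_mono) auto
      also have "\<dots> = 16 * real (r n) ^ 4" by (simp add: power_mult_distrib)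
      finally show ?thesis using le by linarith
    qed
    have "freq A n \<le> (\<Sum>j<Suc (r n) ^ 4. of_bool (A j)) / real n"
      unfolding freq_def using ge by (intro divide_right_mono sum_mono2) auto
    also have "\<dots> \<le> (\<Sum>j<Suc (r n) ^ 4. of_bool (A j)) * (16 / real (Suc (r n) ^ 4))"
      using four n sum_nonneg[of "{..<Suc (r n) ^ 4}" "\<lambda>j. of_bool (A j) :: real"]
      unfolding divide_inverse
      by (intro mult_left_mono) (auto simp: field_simps simp del: of_nat_Suc of_nat_power power_Suc)
    finally show ?thesis by (simp add: freq_def mult.commute)
  qed
  then have "\<forall>\<^sub>F n in sequentially. freq A n \<le> 16 * freq A (Suc (r n) ^ 4)"
    by (auto simp: eventually_sequentially)
  moreover have "(\<lambda>n. 16 * freq A (Suc (r n) ^ 4)) \<longlonglongrightarrow> 16 * 0"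
    by (intro tendsto_mult tendsto_const
        filterlim_compose[OF assms filterlim_compose[OF filterlim_Suc lim]])
  ultimately show ?thesis
    using tendsto_sandwich[OF _ _ tendsto_const, of 0 "freq A"] by (simp add: freq_nonneg)
qed

lemma sum_lessThan_add:
  fixes f :: "nat \<Rightarrow> real"
  shows "sum f {..<m + n} = sum f {..<m} + (\<Sum>j<n. f (m + j))"
  by (induction n) (auto simp: add.assoc)

text \<open>
  A translation by \<open>s\<close> changes the sign of \<open>v j\<close> only when \<open>\<bar>v j\<bar> \<le> \<bar>s\<bar>\<close>, and a delay by \<open>m\<close> affects at most
  \<open>2 * m\<close> indices. This is what makes the fraction of positive times insensitive to the first letters.
\<close>
lemma freq_positive_shift:
  fixes u v :: "nat \<Rightarrow> int"
  assumes uv: "\<And>j. u (m + j) = s + v j"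
    and transient: "freq (\<lambda>j. \<bar>v j\<bar> \<le> \<bar>s\<bar>) \<longlonglongrightarrow> 0"
  shows "(\<lambda>n. freq (\<lambda>j. 0 < u j) n - freq (\<lambda>j. 0 < v j) n) \<longlonglongrightarrow> 0"
proof (rule Lim_null_comparison)
  show "(\<lambda>n. 2 * real m / real n + freq (\<lambda>j. \<bar>v j\<bar> \<le> \<bar>s\<bar>) n) \<longlonglongrightarrow> 0"
    by (intro tendsto_add_zero transient tendsto_divide_0[OF tendsto_const]
        filterlim_mono[OF filterlim_real_sequentially at_top_le_at_infinity order_refl])
  show "\<forall>\<^sub>F n in sequentially. norm (freq (\<lambda>j. 0 < u j) n - freq (\<lambda>j. 0 < v j) n)
      \<le> 2 * real m / real n + freq (\<lambda>j. \<bar>v j\<bar> \<le> \<bar>s\<bar>) n"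
  proof (intro always_eventually allI)
    fix n
    define cu where "cu n = (\<Sum>j<n. of_bool (0 < u j) :: real)" for n
    have 1: "cu (m + n) = cu m + (\<Sum>j<n. of_bool (0 < s + v j))"
      unfolding cu_def sum_lessThan_add uv ..
    have 2: "cu (m + n) = cu n + (\<Sum>j<m. of_bool (0 < u (n + j)))"
      unfolding cu_def add.commute[of m n] sum_lessThan_add ..
    have 3: "0 \<le> cu m" "cu m \<le> m"
      unfolding cu_def by (auto intro!: sum_nonneg sum_of_bool_le simp del: sum_of_bool_eq)
    have 4: "0 \<le> (\<Sum>j<m. of_bool (0 < u (n + j)) :: real)"
        "(\<Sum>j<m. of_bool (0 < u (n + j))) \<le> real m"
      by (auto intro!: sum_nonneg sum_of_bool_le simp del: sum_of_bool_eq)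
    have "\<bar>(\<Sum>j<n. of_bool (0 < s + v j)) - (\<Sum>j<n. of_bool (0 < v j)) :: real\<bar>
        \<le> (\<Sum>j<n. \<bar>of_bool (0 < s + v j) - of_bool (0 < v j)\<bar>)"
      unfolding sum_subtractf[symmetric] by (rule sum_abs)
    also have "\<dots> \<le> (\<Sum>j<n. of_bool (\<bar>v j\<bar> \<le> \<bar>s\<bar>))"
      by (intro sum_mono) auto
    finally have "\<bar>cu n - (\<Sum>j<n. of_bool (0 < v j))\<bar> \<le> 2 * real m + (\<Sum>j<n. of_bool (\<bar>v j\<bar> \<le> \<bar>s\<bar>))"
      using 1 2 3 4 by linarith
    then have "\<bar>cu n - (\<Sum>j<n. of_bool (0 < v j))\<bar> / real n
        \<le> (2 * real m + (\<Sum>j<n. of_bool (\<bar>v j\<bar> \<le> \<bar>s\<bar>))) / real n"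
      by (intro divide_right_mono) auto
    then show "norm (freq (\<lambda>j. 0 < u j) n - freq (\<lambda>j. 0 < v j) n)
      \<le> 2 * real m / real n + freq (\<lambda>j. \<bar>v j\<bar> \<le> \<bar>s\<bar>) n"
      by (simp add: freq_def cu_def add_divide_distrib diff_divide_distrib[symmetric])
  qed
qed

lemma freq_step: "\<bar>freq A (Suc n) - freq A n\<bar> \<le> 1 / real (Suc n)"
proof (cases "n = 0")
  case True
  then show ?thesis by (simp add: freq_def)
next
  case False
  have "freq A (Suc n) - freq A n = (of_bool (A n) - freq A n) / real (Suc n)"
    using False by (simp add: freq_def field_simps)
  moreover have "\<bar>of_bool (A n) - freq A n\<bar> \<le> 1"
    using freq_nonneg[of A n] freq_le_1[of A n] by auto
  ultimately show ?thesis
    by (simp add: abs_divide divide_right_mono del: of_nat_Suc)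
qed

text \<open>
  A discrete intermediate value argument: once the steps are smaller than \<open>e\<close>, a sequence that moves between
  the neighborhoods of 0 and 1 cannot jump over the interval of radius \<open>e\<close> around \<open>l\<close>.
\<close>
lemma freq_cluster_points:
  assumes hi: "\<And>e. 0 < e \<Longrightarrow> \<exists>\<^sub>F n in sequentially. 1 - e < freq A n"
    and lo: "\<And>e. 0 < e \<Longrightarrow> \<exists>\<^sub>F n in sequentially. freq A n < e"
    and l: "0 \<le> l" "l \<le> 1" and e: "0 < e"
  shows "\<exists>\<^sub>F n in sequentially. \<bar>freq A n - l\<bar> < e"
proof (rule ccontr)
  assume "\<not> ?thesis"
  then obtain N where N: "\<And>n. n \<ge> N \<Longrightarrow> e \<le> \<bar>freq A n - l\<bar>"
    by (auto simp: not_frequently eventually_sequentially not_less)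
  obtain N' where N': "1 / e < real N'" using reals_Archimedean2 by blast
  obtain n1 where n1: "n1 \<ge> max N N'" "freq A n1 < e"
    using lo[OF e] unfolding frequently_sequentially by blast
  have below: "freq A n \<le> l - e" if "n \<ge> n1" for n
    using that
  proof (induction n rule: dec_induct)
    case base
    show ?case using N[of n1] n1 l by (auto simp: abs_if split: if_splits)
  next
    case (step n)
    have "1 / e < real (Suc n)" using N' n1 step by linarith
    then have "1 / real (Suc n) < e"
      using e by (simp add: field_simps del: of_nat_Suc)
    then show ?case
      using freq_step[of A n] step N[of "Suc n"] n1 by (auto simp: abs_if split: if_splits)
  qed
  obtain n2 where "n2 \<ge> n1" "1 - e < freq A n2"
    using hi[OF e] by (auto simp: frequently_sequentially)
  then show False using below[of n2] l by auto
qed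

text \<open>
  All that the dynamics needs from a path of the walk. The condition does not mention the starting point
  of the orbit, so a single null set of sequences is exceptional for all starting points at once.
\<close>
definition oscillating :: "(nat \<Rightarrow> int) \<Rightarrow> bool" where
  "oscillating w \<longleftrightarrow> (\<forall>M. freq (\<lambda>j. \<bar>w j\<bar> \<le> M) \<longlonglongrightarrow> 0) \<and>
     (\<forall>e>0. \<exists>\<^sub>F n in sequentially. 1 - e < freq (\<lambda>j. 0 < w j) n) \<and>
     (\<forall>e>0. \<exists>\<^sub>F n in sequentially. 1 - e < freq (\<lambda>j. w j < 0) n)"

lemma oscillating_cluster_points:
  assumes w: "oscillating w" and l: "0 \<le> l" "l \<le> 1" and e: "0 < e"
  shows "\<exists>\<^sub>F n in sequentially. \<bar>freq (\<lambda>j. 0 < w j) n - l\<bar> < e"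
proof (rule freq_cluster_points[OF _ _ l e])
  fix e :: real assume e: "0 < e"
  show "\<exists>\<^sub>F n in sequentially. 1 - e < freq (\<lambda>j. 0 < w j) n"
    using w e by (simp add: oscillating_def)
  have le: "freq (\<lambda>j. 0 < w j) n \<le> 1 - freq (\<lambda>j. w j < 0) n" if "0 < n" for n
  proof -
    have "(\<Sum>j<n. of_bool (0 < w j)) + (\<Sum>j<n. of_bool (w j < 0)) \<le> (\<Sum>j<n. 1 :: real)"
      unfolding sum.distrib[symmetric] by (intro sum_mono) auto
    then show ?thesis using that by (simp add: freq_def field_simps del: sum_of_bool_eq)
  qed
  have "\<forall>\<^sub>F n in sequentially. 1 - e < freq (\<lambda>j. w j < 0) n \<longrightarrow> freq (\<lambda>j. 0 < w j) n < e"
    using eventually_gt_at_top[of "0::nat"]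
  proof eventually_elim
    case (elim n)
    then show ?case using le[of n] by linarith
  qed
  moreover have "\<exists>\<^sub>F n in sequentially. 1 - e < freq (\<lambda>j. w j < 0) n"
    using w e by (simp add: oscillating_def)
  ultimately show "\<exists>\<^sub>F n in sequentially. freq (\<lambda>j. 0 < w j) n < e"
    by (rule frequently_rev_mp[rotated])
qed

section \<open>Past and future of a sequence of independent letters\<close>

lemma (in pair_sigma_finite) AE_pair_fst:
  assumes "AE x in M1. Q x"
  shows "AE z in M1 \<Otimes>\<^sub>M M2. Q (fst z)"
proof -
  obtain N where N: "{x \<in> space M1. \<not> Q x} \<subseteq> N" "N \<in> sets M1" "emeasure M1 N = 0"
    using assms by (auto elim: AE_E)
  note [measurable] = N(2)
  have "AE x in M1. x \<notin> N" using N by (intro AE_not_in) (simp add: null_sets_def)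
  then have "AE z in M1 \<Otimes>\<^sub>M M2. fst z \<notin> N"
    by (intro AE_pair_measure) auto
  then show ?thesis
    using AE_space by eventually_elim (use N(1) in \<open>auto simp: space_pair_measure\<close>)
qed

lemma (in pair_sigma_finite) AE_pair_snd:
  assumes "AE y in M2. Q y"
  shows "AE z in M1 \<Otimes>\<^sub>M M2. Q (snd z)"
proof -
  obtain N where N: "{y \<in> space M2. \<not> Q y} \<subseteq> N" "N \<in> sets M2" "emeasure M2 N = 0"
    using assms by (auto elim: AE_E)
  note [measurable] = N(2)
  have "AE y in M2. y \<notin> N" using N by (intro AE_not_in) (simp add: null_sets_def)
  then have "AE z in M1 \<Otimes>\<^sub>M M2. snd z \<notin> N"
    by (intro AE_pair_measure) auto
  then show ?thesis
    using AE_space by eventually_elim (use N(1) in \<open>auto simp: space_pair_measure\<close>)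
qed

lemma (in sequence_space) emeasure_comb_seq:
  assumes [measurable]: "C \<in> sets S"
  shows "emeasure S C = emeasure (S \<Otimes>\<^sub>M S) {z \<in> space (S \<Otimes>\<^sub>M S). comb_seq n (fst z) (snd z) \<in> C}"
proof -
  have "emeasure S C = emeasure (distr (S \<Otimes>\<^sub>M S) S (\<lambda>(\<omega>, \<omega>'). comb_seq n \<omega> \<omega>')) C"
    by (simp only: PiM_comb_seq)
  also have "\<dots> = emeasure (S \<Otimes>\<^sub>M S)
      ((\<lambda>(\<omega>, \<omega>'). comb_seq n \<omega> \<omega>') -` C \<inter> space (S \<Otimes>\<^sub>M S))"
    by (rule emeasure_distr) measurable
  also have "(\<lambda>(\<omega>, \<omega>'). comb_seq n \<omega> \<omega>') -` C \<inter> space (S \<Otimes>\<^sub>M S)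
      = {z \<in> space (S \<Otimes>\<^sub>M S). comb_seq n (fst z) (snd z) \<in> C}"
    by auto
  finally show ?thesis .
qed

text \<open>
  Concatenating the first \<open>n\<close> letters of one sequence with an independent second sequence reproduces the
  product measure. This is the form of independence of past and future that is used below.
\<close>
lemma (in sequence_space) prob_comb_seq_ge:
  assumes [measurable]: "A \<in> sets S" "B \<in> sets S" "C \<in> sets S"
    and comb: "\<And>\<omega> \<omega>'. \<omega> \<in> A \<Longrightarrow> \<omega>' \<in> B \<Longrightarrow> comb_seq n \<omega> \<omega>' \<in> C"
  shows "P.prob A * P.prob B \<le> P.prob C"
proof -
  have "emeasure S A * emeasure S B = emeasure (S \<Otimes>\<^sub>M S) (A \<times> B)"
    by (rule P.emeasure_pair_measure_Times[symmetric]) measurable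
  also have "\<dots> \<le> emeasure S C"
    unfolding emeasure_comb_seq[OF assms(3), of n]
  proof (rule emeasure_mono)
    show "{z \<in> space (S \<Otimes>\<^sub>M S). comb_seq n (fst z) (snd z) \<in> C} \<in> sets (S \<Otimes>\<^sub>M S)"
      by measurable
  qed (use comb sets.sets_into_space[OF assms(1)] sets.sets_into_space[OF assms(2)]
      in \<open>auto simp: space_pair_measure\<close>)
  finally show ?thesis
    by (simp add: P.emeasure_eq_measure ennreal_mult'[symmetric])
qed

text \<open>
  Conditioning on \<open>C\<close> does not change the probability of a cylinder, because \<open>C\<close> is determined by the
  letters after the cylinder, up to a null set. Cylinders generate the \<open>\<sigma>\<close>-algebra, so the conditioned
  measure is the product measure itself, and \<open>C\<close> has full measure for the former. In contrast to tail
  events, \<open>C\<close> need only be invariant almost surely.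
\<close>
lemma (in sequence_space) zero_one_law:
  assumes C [measurable]: "C \<in> sets S"
    and inv: "\<And>n. AE \<omega>' in S. \<forall>\<omega>. comb_seq n \<omega> \<omega>' \<in> C \<longleftrightarrow> \<omega>' \<in> C"
    and pos: "P.prob C \<noteq> 0"
  shows "P.prob C = 1"
proof -
  have C0: "emeasure S C \<noteq> 0" and Cfin: "emeasure S C \<noteq> \<infinity>"
    using pos by (simp_all add: P.emeasure_eq_measure)
  have "uniform_measure S C = S"
  proof (rule measure_eqI_PiM_infinite[where I = "UNIV::nat set" and M = "\<lambda>_. M"])
    fix A :: "nat \<Rightarrow> _" and J :: "nat set" assume J: "finite J" "J \<subseteq> UNIV" "\<And>i. i \<in> J \<Longrightarrow> A i \<in> sets M"
    let ?X = "emb UNIV J (Pi\<^sub>E J A)"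
    have X [measurable]: "?X \<in> sets S"
      using J by (intro sets_PiM_I) auto
    obtain n where n: "J \<subseteq> {..<n}"
      using J(1) by (meson finite_nat_iff_bounded)
    have combX: "comb_seq n \<omega> \<omega>' \<in> ?X \<longleftrightarrow> \<omega> \<in> ?X" if "\<omega> \<in> space S" "\<omega>' \<in> space S" for \<omega> \<omega>'
      using that n
      by (auto simp: prod_emb_def space_PiM PiE_iff comb_seq_def subset_eq)
    interpret SS: pair_sigma_finite S S ..
    have snd_AE: "AE z in S \<Otimes>\<^sub>M S. \<forall>\<omega>. comb_seq n \<omega> (snd z) \<in> C \<longleftrightarrow> snd z \<in> C"
      by (rule SS.AE_pair_snd[OF inv])
    have "emeasure S (C \<inter> ?X) =
        emeasure (S \<Otimes>\<^sub>M S) {z \<in> space (S \<Otimes>\<^sub>M S). comb_seq n (fst z) (snd z) \<in> C \<inter> ?X}"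
      by (rule emeasure_comb_seq) measurable
    also have "\<dots> = emeasure (S \<Otimes>\<^sub>M S) (?X \<times> C)"
    proof (rule emeasure_eq_AE)
      show "AE z in S \<Otimes>\<^sub>M S. z \<in> {z \<in> space (S \<Otimes>\<^sub>M S). comb_seq n (fst z) (snd z) \<in> C \<inter> ?X}
          \<longleftrightarrow> z \<in> ?X \<times> C"
        using snd_AE AE_space
      proof eventually_elim
        case (elim z)
        then show ?case
          using combX[of "fst z" "snd z"] by (cases z) (auto simp: space_pair_measure)
      qed
    qed measurable
    also have "\<dots> = emeasure S ?X * emeasure S C"
      by (rule P.emeasure_pair_measure_Times) measurable
    finally show "emeasure (uniform_measure S C) ?X = emeasure S ?X"
      using C0 Cfin by (simp add: ennreal_mult_divide_eq)
  next
    show "finite_measure (uniform_measure S C)"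
      using C0 Cfin by (intro prob_space.finite_measure prob_space_uniform_measure) auto
  qed simp_all
  then have "emeasure (uniform_measure S C) C = emeasure S C" by simp
  then show ?thesis
    using pos C0 by (simp add: P.emeasure_eq_measure divide_ennreal)
qed

section \<open>Null recurrence of centered integer walks\<close>

definition walk :: "('a \<Rightarrow> int) \<Rightarrow> (nat \<Rightarrow> 'a) \<Rightarrow> nat \<Rightarrow> int" where
  "walk \<zeta> \<omega> n = (\<Sum>i<n. \<zeta> (\<omega> i))"

lemma walk_0 [simp]: "walk \<zeta> \<omega> 0 = 0"
  by (simp add: walk_def)

lemma walk_Suc: "walk \<zeta> \<omega> (Suc n) = walk \<zeta> \<omega> n + \<zeta> (\<omega> n)"
  by (simp add: walk_def)

lemma walk_comb_seq: "walk \<zeta> (comb_seq m \<omega> \<omega>') (m + j) = walk \<zeta> \<omega> m + walk \<zeta> \<omega>' j"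
proof (induction j)
  case 0
  show ?case by (simp add: walk_def comb_seq_less)
next
  case (Suc j)
  then show ?case using comb_seq_add[of m \<omega> \<omega>' j] by (simp add: walk_Suc add.commute)
qed

lemma walk_uminus: "walk (\<lambda>a. - \<zeta> a) \<omega> n = - walk \<zeta> \<omega> n"
  by (simp add: walk_def sum_negf)

text \<open>The integral of the series is finite, so almost every series converges.\<close>
lemma AE_tendsto_0_if_summable_integral:
  fixes f :: "nat \<Rightarrow> 'a \<Rightarrow> real"
  assumes int: "\<And>k. integrable M (f k)" and nonneg: "\<And>k x. 0 \<le> f k x"
    and bound: "\<And>k. (\<integral>x. f k x \<partial>M) \<le> b k" and b: "summable b"
  shows "AE x in M. (\<lambda>k. f k x) \<longlonglongrightarrow> 0"
proof -
  have b0: "0 \<le> b k" for k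
    by (rule order_trans[OF Bochner_Integration.integral_nonneg bound]) (simp add: nonneg)
  have [measurable]: "f k \<in> borel_measurable M" for k
    using int by auto
  have "(\<integral>\<^sup>+x. (\<Sum>k. ennreal (f k x)) \<partial>M) = (\<Sum>k. \<integral>\<^sup>+x. ennreal (f k x) \<partial>M)"
    by (rule nn_integral_suminf) measurable
  also have "\<dots> = (\<Sum>k. ennreal (\<integral>x. f k x \<partial>M))"
    by (intro suminf_cong nn_integral_eq_integral int) (simp add: nonneg)
  also have "\<dots> \<le> (\<Sum>k. ennreal (b k))"
    by (intro suminf_le summableI ennreal_leI bound)
  also have "\<dots> = ennreal (\<Sum>k. b k)"
    using b0 b by (rule suminf_ennreal2)
  finally have "(\<integral>\<^sup>+x. (\<Sum>k. ennreal (f k x)) \<partial>M) \<noteq> \<infinity>"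
    by (auto simp: top_unique)
  then have "AE x in M. (\<Sum>k. ennreal (f k x)) \<noteq> \<infinity>"
    by (intro nn_integral_PInf_AE) measurable
  then show ?thesis
  proof eventually_elim
    case (elim x)
    then have "summable (\<lambda>k. f k x)"
      by (intro summable_suminf_not_top) (simp_all add: nonneg)
    then show ?case by (rule summable_LIMSEQ_zero)
  qed
qed

locale centered_walk = sequence_space "measure_pmf p" for p :: "'a pmf" +
  fixes \<zeta> :: "'a \<Rightarrow> int"
  assumes square_integrable: "integrable (measure_pmf p) (\<lambda>a. (real_of_int (\<zeta> a))\<^sup>2)"
    and mean: "(\<integral>a. real_of_int (\<zeta> a) \<partial>measure_pmf p) = 0"
    and variance_pos: "0 < (\<integral>a. (real_of_int (\<zeta> a))\<^sup>2 \<partial>measure_pmf p)"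
begin

definition V :: real where "V = (\<integral>a. (real_of_int (\<zeta> a))\<^sup>2 \<partial>measure_pmf p)"

definition X :: "nat \<Rightarrow> (nat \<Rightarrow> 'a) \<Rightarrow> real" where "X i \<omega> = real_of_int (\<zeta> (\<omega> i))"

definition W :: "nat \<Rightarrow> (nat \<Rightarrow> 'a) \<Rightarrow> real" where "W n \<omega> = real_of_int (walk \<zeta> \<omega> n)"

lemma V_pos: "0 < V"
  using variance_pos by (simp add: V_def)

lemma W_eq: "W n \<omega> = (\<Sum>i<n. X i \<omega>)"
  by (simp add: W_def X_def walk_def)

lemma measurable_X [measurable]: "X i \<in> borel_measurable S"
proof -
  have [measurable]: "(\<lambda>a. real_of_int (\<zeta> a)) \<in> measure_pmf p \<rightarrow>\<^sub>M borel" by simp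
  show ?thesis unfolding X_def by measurable
qed

lemma measurable_W [measurable]: "W n \<in> borel_measurable S"
  unfolding W_eq by measurable

lemma distr_coordinate: "distr S (measure_pmf p) (\<lambda>\<omega>. \<omega> i) = measure_pmf p"
  by (rule PiM_component) simp

lemma expectation_coordinate:
  fixes g :: "'a \<Rightarrow> real"
  shows "P.expectation (\<lambda>\<omega>. g (\<omega> i)) = (\<integral>a. g a \<partial>measure_pmf p)"
proof -
  have "(\<integral>a. g a \<partial>distr S (measure_pmf p) (\<lambda>\<omega>. \<omega> i)) = P.expectation (\<lambda>\<omega>. g (\<omega> i))"
    by (rule integral_distr) auto
  then show ?thesis by (simp only: distr_coordinate)
qed

lemma integrable_coordinate:
  fixes g :: "'a \<Rightarrow> real"
  shows "integrable S (\<lambda>\<omega>. g (\<omega> i)) \<longleftrightarrow> integrable (measure_pmf p) g"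
proof -
  have "integrable (distr S (measure_pmf p) (\<lambda>\<omega>. \<omega> i)) g \<longleftrightarrow> integrable S (\<lambda>\<omega>. g (\<omega> i))"
    by (rule integrable_distr_eq) auto
  then show ?thesis by (simp only: distr_coordinate)
qed

lemma X_square: "integrable S (\<lambda>\<omega>. (X i \<omega>)\<^sup>2)" "P.expectation (\<lambda>\<omega>. (X i \<omega>)\<^sup>2) = V"
  using square_integrable expectation_coordinate[of "\<lambda>a. (real_of_int (\<zeta> a))\<^sup>2" i]
  by (simp_all add: X_def V_def integrable_coordinate[of "\<lambda>a. (real_of_int (\<zeta> a))\<^sup>2" i])

lemma X_integrable: "integrable S (X i)"
  by (rule P.square_integrable_imp_integrable[OF _ X_square(1)]) measurable

lemma X_mean: "P.expectation (X i) = 0"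
  using expectation_coordinate[of "\<lambda>a. real_of_int (\<zeta> a)" i] mean by (simp add: X_def[abs_def])

lemma X_indep: "P.indep_vars (\<lambda>_. borel) X UNIV"
proof -
  have "P.indep_vars (\<lambda>_. measure_pmf p) (\<lambda>i \<omega>. \<omega> i) UNIV"
    by (subst P.indep_vars_iff_distr_eq_PiM) (auto simp: distr_coordinate restrict_UNIV)
  then have "P.indep_vars (\<lambda>_. borel) (\<lambda>i \<omega>. (\<lambda>a. real_of_int (\<zeta> a)) (\<omega> i)) UNIV"
    by (rule P.indep_vars_compose2) simp
  then show ?thesis by (simp add: X_def[abs_def])
qed

lemma X_indep_W: "P.indep_var borel (X n) borel (W n)"
  unfolding W_eq by (rule P.indep_vars_sum) (auto intro: P.indep_vars_subset[OF X_indep])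

lemma W_integrable: "integrable S (W n)"
  unfolding W_eq by (intro Bochner_Integration.integrable_sum X_integrable)

lemma W_square: "integrable S (\<lambda>\<omega>. (W n \<omega>)\<^sup>2) \<and> P.expectation (\<lambda>\<omega>. (W n \<omega>)\<^sup>2) = n * V"
proof (induction n)
  case 0
  then show ?case by (simp add: W_def)
next
  case (Suc n)
  have eq: "(W (Suc n) \<omega>)\<^sup>2 = (W n \<omega>)\<^sup>2 + (2 * (X n \<omega> * W n \<omega>) + (X n \<omega>)\<^sup>2)" for \<omega>
    by (simp add: W_eq power2_eq_square algebra_simps)
  have cross: "integrable S (\<lambda>\<omega>. X n \<omega> * W n \<omega>)" "P.expectation (\<lambda>\<omega>. X n \<omega> * W n \<omega>) = 0"
    using P.indep_var_integrable[OF X_indep_W X_integrable W_integrable]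
      P.indep_var_lebesgue_integral[OF X_indep_W X_integrable W_integrable]
    by (simp_all add: X_mean)
  show ?case
    unfolding eq using Suc cross X_square by (simp add: algebra_simps)
qed

lemma W_abs_le: "P.expectation (\<lambda>\<omega>. \<bar>W n \<omega>\<bar>) \<le> sqrt (n * V)"
proof -
  have "0 \<le> P.variance (\<lambda>\<omega>. \<bar>W n \<omega>\<bar>)"
    by (rule P.variance_positive)
  also have "\<dots> = n * V - (P.expectation (\<lambda>\<omega>. \<bar>W n \<omega>\<bar>))\<^sup>2"
    using W_square[of n] W_integrable[of n] by (subst P.variance_eq) auto
  finally show ?thesis by (intro real_le_rsqrt) simp
qed

lemma X_abs: "P.expectation (\<lambda>\<omega>. \<bar>X i \<omega>\<bar>) = (\<integral>a. \<bar>real_of_int (\<zeta> a)\<bar> \<partial>measure_pmf p)"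
  using expectation_coordinate[of "\<lambda>a. \<bar>real_of_int (\<zeta> a)\<bar>" i] by (simp add: X_def)

lemma mean_abs_pos: "0 < (\<integral>a. \<bar>real_of_int (\<zeta> a)\<bar> \<partial>measure_pmf p)"
proof (rule ccontr)
  assume "\<not> ?thesis"
  moreover have int: "integrable (measure_pmf p) (\<lambda>a. \<bar>real_of_int (\<zeta> a)\<bar>)"
    using X_integrable[of 0] integrable_coordinate[of "\<lambda>a. real_of_int (\<zeta> a)" 0]
    by (simp add: X_def[abs_def])
  moreover have "0 \<le> (\<integral>a. \<bar>real_of_int (\<zeta> a)\<bar> \<partial>measure_pmf p)" by simp
  ultimately have "AE a in measure_pmf p. \<bar>real_of_int (\<zeta> a)\<bar> = 0"
    using integral_nonneg_eq_0_iff_AE[OF int] by simp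
  then have "(\<integral>a. (real_of_int (\<zeta> a))\<^sup>2 \<partial>measure_pmf p) = (\<integral>a. 0 \<partial>measure_pmf p)"
    by (intro integral_cong_AE) auto
  then show False using variance_pos by simp
qed

lemma
  shows integrable_visit: "integrable S (\<lambda>\<omega>. of_bool (W n \<omega> = y) :: real)"
    and expectation_visit:
      "P.expectation (\<lambda>\<omega>. of_bool (W n \<omega> = y) :: real) = P.prob {\<omega> \<in> space S. W n \<omega> = y}"
proof -
  show "integrable S (\<lambda>\<omega>. of_bool (W n \<omega> = y) :: real)"
    by (rule P.integrable_const_bound[where B = 1]) auto
  have "P.expectation (\<lambda>\<omega>. of_bool (W n \<omega> = y) :: real)
      = P.expectation (indicator {\<omega> \<in> space S. W n \<omega> = y})"
    by (intro Bochner_Integration.integral_cong) (auto simp: indicator_def)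
  then show "P.expectation (\<lambda>\<omega>. of_bool (W n \<omega> = y) :: real) = P.prob {\<omega> \<in> space S. W n \<omega> = y}"
    by simp
qed

text \<open>
  Integrate the pointwise inequality \<open>\<bar>w + x - y\<bar> \<ge> \<bar>w - y\<bar> + x * sgn (w - y) + \<bar>x\<bar> * of_bool (w = y)\<close> with
  \<open>w\<close> the position and \<open>x\<close> the independent centered step: the middle term has mean 0.
\<close>
lemma W_abs_step:
  "P.expectation (\<lambda>\<omega>. \<bar>W n \<omega> - y\<bar>)
     + (\<integral>a. \<bar>real_of_int (\<zeta> a)\<bar> \<partial>measure_pmf p) * P.prob {\<omega> \<in> space S. W n \<omega> = y}
   \<le> P.expectation (\<lambda>\<omega>. \<bar>W (Suc n) \<omega> - y\<bar>)"
proof -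
  have [simp]: "integrable S (\<lambda>\<omega>. sgn (W n \<omega> - y))"
    by (rule P.integrable_const_bound[where B = 1]) (auto simp: abs_sgn_eq)
  have ind1: "P.indep_var borel (X n) borel (\<lambda>\<omega>. sgn (W n \<omega> - y))"
    using P.indep_var_compose[OF X_indep_W, of "\<lambda>x. x" borel "\<lambda>w. sgn (w - y)" borel n]
    by (simp add: comp_def)
  have ind2: "P.indep_var borel (\<lambda>\<omega>. \<bar>X n \<omega>\<bar>) borel (\<lambda>\<omega>. of_bool (W n \<omega> = y) :: real)"
    using P.indep_var_compose[OF X_indep_W, of "\<lambda>x. \<bar>x\<bar>" borel "\<lambda>w. of_bool (w = y) :: real" borel n]
    by (simp add: comp_def)
  have i1: "integrable S (\<lambda>\<omega>. X n \<omega> * sgn (W n \<omega> - y))"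
    "P.expectation (\<lambda>\<omega>. X n \<omega> * sgn (W n \<omega> - y)) = 0"
    using P.indep_var_integrable[OF ind1 X_integrable] P.indep_var_lebesgue_integral[OF ind1 X_integrable]
    by (simp_all add: X_mean)
  have i2: "integrable S (\<lambda>\<omega>. \<bar>X n \<omega>\<bar> * of_bool (W n \<omega> = y))"
    "P.expectation (\<lambda>\<omega>. \<bar>X n \<omega>\<bar> * of_bool (W n \<omega> = y)) =
      (\<integral>a. \<bar>real_of_int (\<zeta> a)\<bar> \<partial>measure_pmf p) * P.prob {\<omega> \<in> space S. W n \<omega> = y}"
    using P.indep_var_integrable[OF ind2] P.indep_var_lebesgue_integral[OF ind2] X_integrable[of n]
    by (simp_all add: X_abs expectation_visit integrable_visit)
  have i0: "integrable S (\<lambda>\<omega>. \<bar>W n \<omega> - y\<bar>)" for n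
    using W_integrable[of n] by simp
  have "P.expectation (\<lambda>\<omega>. \<bar>W n \<omega> - y\<bar> + X n \<omega> * sgn (W n \<omega> - y)
      + \<bar>X n \<omega>\<bar> * of_bool (W n \<omega> = y)) \<le> P.expectation (\<lambda>\<omega>. \<bar>W (Suc n) \<omega> - y\<bar>)"
  proof (rule integral_mono)
    show "\<bar>W n \<omega> - y\<bar> + X n \<omega> * sgn (W n \<omega> - y) + \<bar>X n \<omega>\<bar> * of_bool (W n \<omega> = y)
        \<le> \<bar>W (Suc n) \<omega> - y\<bar>" for \<omega>
      by (auto simp: W_eq sgn_if abs_if)
  qed (use i0 i1 i2 in auto)
  then show ?thesis using i0 i1 i2 by simp
qed

text \<open>Summing the gains of \<open>E \<bar>W n - y\<bar>\<close> bounds the expected number of visits by its final value.\<close>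
lemma sum_prob_visit_le:
  "(\<integral>a. \<bar>real_of_int (\<zeta> a)\<bar> \<partial>measure_pmf p) * (\<Sum>j<n. P.prob {\<omega> \<in> space S. W j \<omega> = y})
    \<le> sqrt (n * V)"
proof -
  let ?m = "\<integral>a. \<bar>real_of_int (\<zeta> a)\<bar> \<partial>measure_pmf p"
  have "\<bar>y\<bar> + ?m * (\<Sum>j<n. P.prob {\<omega> \<in> space S. W j \<omega> = y}) \<le> P.expectation (\<lambda>\<omega>. \<bar>W n \<omega> - y\<bar>)"
  proof (induction n)
    case 0
    then show ?case by (simp add: W_def P.prob_space)
  next
    case (Suc n)
    then show ?case using W_abs_step[of n y] by (simp add: distrib_left)
  qed
  also have "P.expectation (\<lambda>\<omega>. \<bar>W n \<omega> - y\<bar>) \<le> P.expectation (\<lambda>\<omega>. \<bar>W n \<omega>\<bar> + \<bar>y\<bar>)"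
    using W_integrable[of n] by (intro integral_mono) auto
  also have "\<dots> = P.expectation (\<lambda>\<omega>. \<bar>W n \<omega>\<bar>) + \<bar>y\<bar>"
    using W_integrable[of n] by (simp add: P.prob_space)
  finally show ?thesis using W_abs_le[of n] by simp
qed

text \<open>
  The expected frequency at time \<open>n\<close> is at most of order \<open>1 / \<surd>n\<close>, and fourth powers are sparse enough to make this
  summable.
\<close>
lemma AE_freq_visit: "AE \<omega> in S. freq (\<lambda>j. walk \<zeta> \<omega> j = y) \<longlonglongrightarrow> 0"
proof -
  let ?m = "\<integral>a. \<bar>real_of_int (\<zeta> a)\<bar> \<partial>measure_pmf p"
  have eq: "walk \<zeta> \<omega> j = y \<longleftrightarrow> W j \<omega> = real_of_int y" for \<omega> j
    by (simp add: W_def)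
  have "AE \<omega> in S. (\<lambda>k. freq (\<lambda>j. walk \<zeta> \<omega> j = y) (k ^ 4)) \<longlonglongrightarrow> 0"
  proof (rule AE_tendsto_0_if_summable_integral)
    show "integrable S (\<lambda>\<omega>. freq (\<lambda>j. walk \<zeta> \<omega> j = y) (k ^ 4))" for k
      unfolding freq_def eq by (intro integrable_divide Bochner_Integration.integrable_sum integrable_visit)
    show "P.expectation (\<lambda>\<omega>. freq (\<lambda>j. walk \<zeta> \<omega> j = y) (k ^ 4)) \<le> sqrt V / ?m * inverse ((real k)\<^sup>2)" for k
    proof (cases "k = 0")
      case True
      then show ?thesis by (simp add: freq_def)
    next
      case False
      have "P.expectation (\<lambda>\<omega>. freq (\<lambda>j. walk \<zeta> \<omega> j = y) (k ^ 4))
          = (\<Sum>j<k ^ 4. P.prob {\<omega> \<in> space S. W j \<omega> = real_of_int y}) / real (k ^ 4)"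
        unfolding freq_def eq by (simp add: integrable_visit expectation_visit del: sum_of_bool_eq)
      also have "\<dots> \<le> sqrt (real (k ^ 4) * V) / ?m / real (k ^ 4)"
        using sum_prob_visit_le[where n = "k ^ 4" and y = "real_of_int y"] mean_abs_pos
        by (intro divide_right_mono) (simp_all add: field_simps)
      also have "sqrt (real (k ^ 4) * V) = (real k)\<^sup>2 * sqrt V"
        using real_sqrt_abs[of "(real k)\<^sup>2"] by (simp add: real_sqrt_mult flip: power_mult)
      also have "\<dots> / ?m / real (k ^ 4) = sqrt V / ?m * inverse ((real k)\<^sup>2)"
        using False mean_abs_pos by (simp add: field_simps flip: power_add)
      finally show ?thesis .
    qed
    show "summable (\<lambda>k. sqrt V / ?m * inverse ((real k)\<^sup>2))"
      by (intro summable_mult inverse_power_summable) simp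
  qed (rule freq_nonneg)
  then show ?thesis
    by eventually_elim (rule freq_tendsto_0_if_fourth_powers)
qed

lemma AE_freq_bounded: "AE \<omega> in S. \<forall>M. freq (\<lambda>j. \<bar>walk \<zeta> \<omega> j\<bar> \<le> M) \<longlonglongrightarrow> 0"
proof -
  have "AE \<omega> in S. \<forall>y. freq (\<lambda>j. walk \<zeta> \<omega> j = y) \<longlonglongrightarrow> 0"
    by (subst AE_all_countable) (simp add: AE_freq_visit)
  then show ?thesis
  proof eventually_elim
    case (elim \<omega>)
    have "freq (\<lambda>j. \<bar>walk \<zeta> \<omega> j\<bar> \<le> M) = (\<lambda>n. \<Sum>y\<in>{-M..M}. freq (\<lambda>j. walk \<zeta> \<omega> j = y) n)" for M
    proof
      fix n
      have "of_bool (\<bar>w\<bar> \<le> M) = (\<Sum>y\<in>{-M..M}. of_bool (w = y) :: real)" for w :: int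
        by (auto simp: of_bool_def sum.delta')
      then have "(\<Sum>j<n. of_bool (\<bar>walk \<zeta> \<omega> j\<bar> \<le> M)) 
          = (\<Sum>j<n. \<Sum>y\<in>{-M..M}. of_bool (walk \<zeta> \<omega> j = y) :: real)"
        by (intro sum.cong refl) blast
      also have "\<dots> = (\<Sum>y\<in>{-M..M}. \<Sum>j<n. of_bool (walk \<zeta> \<omega> j = y))"
        by (rule sum.swap)
      finally show "freq (\<lambda>j. \<bar>walk \<zeta> \<omega> j\<bar> \<le> M) n = (\<Sum>y\<in>{-M..M}. freq (\<lambda>j. walk \<zeta> \<omega> j = y) n)"
        unfolding freq_def by (simp only: sum_divide_distrib)
    qed
    then show ?case using elim by (auto intro!: tendsto_null_sum)
  qed
qed

end

section \<open>Long excursions of the walk\<close>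

lemma std_normal_upper_tail_pos: "measure std_normal_distribution {t<..} > 0"
proof -
  interpret N: real_distribution std_normal_distribution
    by (rule real_dist_normal_dist)
  have "emeasure std_normal_distribution {t<..} \<noteq> 0"
  proof
    assume "emeasure std_normal_distribution {t<..} = 0"
    then have "(\<integral>\<^sup>+x. ennreal (std_normal_density x) * indicator {t<..} x \<partial>lborel) = 0"
      by (simp add: emeasure_density)
    then have "AE x in lborel. ennreal (std_normal_density x) * indicator {t<..} x = 0"
      by (subst (asm) nn_integral_0_iff_AE) auto
    then have "AE x in lborel. x \<notin> {t<..}"
    proof eventually_elim
      case (elim x)
      then show ?case
        using normal_density_pos[of 1 0 x] by (auto simp: indicator_def split: if_splits)
    qed
    then have "emeasure lborel {t<..} = 0"
      by (simp add: AE_iff_measurable[OF _ refl] greaterThan_def)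
    moreover have "emeasure lborel {t<..<t + 1} \<le> emeasure lborel {t<..}"
      by (intro emeasure_mono) auto
    ultimately show False by simp
  qed
  then show ?thesis
    by (simp add: N.emeasure_eq_measure zero_less_measure_iff)
qed

lemma isCont_cdf_std_normal: "isCont (cdf std_normal_distribution) t"
proof -
  interpret N: real_distribution std_normal_distribution
    by (rule real_dist_normal_dist)
  have "emeasure std_normal_distribution {t} = 0"
    by (subst emeasure_density) (auto simp: nn_integral_0_iff_AE intro!: AE_I[of _ _ "{t}"])
  then show ?thesis
    by (simp add: N.isCont_cdf N.emeasure_eq_measure)
qed

context centered_walk
begin

lemma space_S [simp]: "space S = UNIV"
  by (simp add: space_PiM)

text \<open>By the central limit theorem the probability converges to a tail of the normal distribution.\<close>
lemma eventually_W_gt_sqrt: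
  "\<exists>\<delta>>0. \<forall>\<^sub>F n in sequentially. \<delta> \<le> P.prob {\<omega>. c * sqrt n < W n \<omega>}"
proof -
  interpret N: real_distribution std_normal_distribution
    by (rule real_dist_normal_dist)
  let ?D = "\<lambda>n. distr S borel (\<lambda>\<omega>. (\<Sum>i<n. X i \<omega>) / sqrt (n * (sqrt V)\<^sup>2))"
  define t where "t = c / sqrt V"
  define \<delta> where "\<delta> = measure std_normal_distribution {t<..} / 2"
  have \<delta>: "0 < \<delta>"
    using std_normal_upper_tail_pos[of t] by (simp add: \<delta>_def)
  have "weak_conv_m ?D std_normal_distribution"
  proof (rule P.central_limit_theorem_zero_mean[OF X_indep X_mean _ X_square(1), of _ "distr S borel (X 0)"])
    show "0 < sqrt V" using V_pos by simp
    show "P.variance (X n) = (sqrt V)\<^sup>2" for n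
      using X_square[of n] V_pos by (simp add: X_mean)
    show "distr S borel (X n) = distr S borel (X 0)" for n
    proof -
      have "distr S borel (X n) = distr (distr S (measure_pmf p) (\<lambda>\<omega>. \<omega> n)) borel (\<lambda>a. real_of_int (\<zeta> a))" for n
        by (subst distr_distr) (auto simp: comp_def X_def[abs_def])
      then show ?thesis by (simp only: distr_coordinate)
    qed
  qed
  then have "(\<lambda>n. cdf (?D n) t) \<longlonglongrightarrow> cdf std_normal_distribution t"
    using isCont_cdf_std_normal by (simp add: weak_conv_m_def weak_conv_def)
  moreover have "cdf std_normal_distribution t = 1 - 2 * \<delta>"
  proof -
    have "{t<..} = space std_normal_distribution - {..t}" by auto
    then have "2 * \<delta> = 1 - cdf std_normal_distribution t"
      unfolding \<delta>_def cdf_def using N.prob_compl[of "{..t}"] by simp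
    then show ?thesis by simp
  qed
  ultimately have "\<forall>\<^sub>F n in sequentially. cdf (?D n) t < 1 - \<delta>"
    using \<delta> by (intro order_tendstoD(2)[of _ "1 - 2 * \<delta>"]) auto
  moreover have "\<forall>\<^sub>F n in sequentially. 0 < n"
    by (rule eventually_gt_at_top)
  ultimately have "\<forall>\<^sub>F n in sequentially. \<delta> \<le> P.prob {\<omega>. c * sqrt n < W n \<omega>}"
  proof eventually_elim
    case (elim n)
    have V: "sqrt (n * (sqrt V)\<^sup>2) = sqrt n * sqrt V"
      using V_pos by (simp add: real_sqrt_mult)
    have "cdf (?D n) t = P.prob ((\<lambda>\<omega>. (\<Sum>i<n. X i \<omega>) / sqrt (n * (sqrt V)\<^sup>2)) -` {..t} \<inter> space S)"
      unfolding cdf_def by (rule measure_distr) auto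
    also have "\<dots> = P.prob (space S - {\<omega>. c * sqrt n < W n \<omega>})"
      unfolding V using V_pos elim
      by (intro arg_cong[where f = P.prob]) (auto simp: W_eq t_def field_simps)
    also have "\<dots> = 1 - P.prob {\<omega>. c * sqrt n < W n \<omega>}"
    proof (rule P.prob_compl)
      have "{\<omega> \<in> space S. c * sqrt n < W n \<omega>} \<in> P.events" by measurable
      then show "{\<omega>. c * sqrt n < W n \<omega>} \<in> P.events" by simp
    qed
    finally show ?case using elim by simp
  qed
  then show ?thesis using \<delta> by blast
qed

text \<open>
  By Chebyshev's inequality, at each of the \<open>K * n\<close> times the walk is below \<open>- c * \<surd>n\<close> with probability at
  most \<open>K * V / c\<^sup>2\<close>. The expected number of such times is then at most \<open>n / 2\<close>, and Markov's inequality
  applies.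
\<close>
lemma prob_few_returns:
  assumes n: "0 < n" and c: "0 < c" "2 * (real K)\<^sup>2 * V \<le> c\<^sup>2"
  shows "1 / 2 \<le> P.prob {\<omega>. (\<Sum>j<K * n. of_bool (W j \<omega> \<le> - c * sqrt n)) < real n}"
proof -
  let ?D = "\<lambda>\<omega>. \<Sum>j<K * n. (of_bool (W j \<omega> \<le> - c * sqrt n) :: real)"
  have int: "integrable S (\<lambda>\<omega>. of_bool (W j \<omega> \<le> - c * sqrt n) :: real)" for j
    by (rule P.integrable_const_bound[where B = 1]) auto
  have intD: "integrable S ?D"
    by (intro Bochner_Integration.integrable_sum int)
  have c2: "0 < c\<^sup>2 * real n" using n c by simp
  have le: "P.expectation (\<lambda>\<omega>. of_bool (W j \<omega> \<le> - c * sqrt n)) \<le> real K * V / c\<^sup>2" if j: "j < K * n" for j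
  proof -
    have "P.expectation (\<lambda>\<omega>. of_bool (W j \<omega> \<le> - c * sqrt n))
        \<le> P.expectation (\<lambda>\<omega>. (W j \<omega>)\<^sup>2 / (c\<^sup>2 * real n))"
    proof (rule integral_mono[OF int])
      show "of_bool (W j \<omega> \<le> - c * sqrt n) \<le> (W j \<omega>)\<^sup>2 / (c\<^sup>2 * real n)" for \<omega>
      proof (cases "W j \<omega> \<le> - c * sqrt n")
        case True
        then have "(c * sqrt n)\<^sup>2 \<le> (- W j \<omega>)\<^sup>2"
          using c by (intro power_mono) auto
        then show ?thesis using True c2 by (simp add: power_mult_distrib)
      qed (use c2 in auto)
    qed (use W_square in auto)
    also have "\<dots> = real j * V / (c\<^sup>2 * real n)"
      using W_square by simp
    also have "\<dots> \<le> real (K * n) * V / (c\<^sup>2 * real n)"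
      using j V_pos c2 by (intro divide_right_mono mult_right_mono) (auto simp del: of_nat_mult)
    also have "\<dots> = real K * V / c\<^sup>2"
      using n by simp
    finally show ?thesis .
  qed
  have "P.expectation ?D = (\<Sum>j<K * n. P.expectation (\<lambda>\<omega>. of_bool (W j \<omega> \<le> - c * sqrt n)))"
    by (intro Bochner_Integration.integral_sum int)
  also have "\<dots> \<le> (\<Sum>j<K * n. real K * V / c\<^sup>2)"
    by (intro sum_mono le) simp
  also have "\<dots> = real n * ((real K)\<^sup>2 * V / c\<^sup>2)"
    by (simp add: power2_eq_square)
  also have "\<dots> \<le> real n * (1 / 2)"
    using c by (intro mult_left_mono) (auto simp: field_simps)
  finally have ED: "P.expectation ?D \<le> real n / 2" by simp
  have "P.prob {\<omega> \<in> space S. ?D \<omega> \<ge> real n} \<le> P.expectation ?D / real n"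
    using n by (intro integral_Markov_inequality_measure[where A = "space S"] intD sets.top)
      (auto intro!: sum_nonneg simp del: sum_of_bool_eq)
  also have "\<dots> \<le> 1 / 2"
    using ED n by (simp add: field_simps)
  finally have "P.prob {\<omega> \<in> space S. ?D \<omega> \<ge> real n} \<le> 1 / 2" .
  moreover have "P.prob {\<omega> \<in> space S. \<not> ?D \<omega> \<ge> real n} = 1 - P.prob {\<omega> \<in> space S. ?D \<omega> \<ge> real n}"
    by (rule P.prob_neg) measurable
  ultimately show ?thesis by (simp add: not_le)
qed

text \<open>
  A lead of \<open>c * \<surd>n\<close> at time \<open>n\<close> that is undone at fewer than \<open>n\<close> of the next \<open>K * n\<close> times leaves more than
  \<open>(K - 1) * n\<close> positive times among the first \<open>(K + 1) * n\<close>.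
\<close>
lemma eventually_mostly_positive:
  "\<exists>\<delta>>0. \<forall>\<^sub>F n in sequentially. \<delta> \<le>
     P.prob {\<omega>. 1 - 2 / real (Suc K) \<le> freq (\<lambda>j. 0 < W j \<omega>) (Suc K * n)}"
proof -
  \<comment> \<open>With \<open>Suc K\<close> in place of \<open>K\<close> the constant is positive also for \<open>K = 0\<close>.\<close>
  define c where "c = sqrt (2 * V) * real (Suc K)"
  have c: "0 < c" "2 * (real K)\<^sup>2 * V \<le> c\<^sup>2"
    using V_pos by (simp_all add: c_def power_mult_distrib mult_right_mono power_mono)
  obtain \<delta> where \<delta>: "0 < \<delta>" "\<forall>\<^sub>F n in sequentially. \<delta> \<le> P.prob {\<omega>. c * sqrt n < W n \<omega>}"
    using eventually_W_gt_sqrt by blast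
  have "\<forall>\<^sub>F n in sequentially. \<delta> / 2 \<le>
     P.prob {\<omega>. 1 - 2 / real (Suc K) \<le> freq (\<lambda>j. 0 < W j \<omega>) (Suc K * n)}"
    using \<delta>(2) eventually_gt_at_top[of 0]
  proof eventually_elim
    case (elim n)
    let ?A = "{\<omega>. c * sqrt n < W n \<omega>}"
    let ?B = "{\<omega>. (\<Sum>j<K * n. of_bool (W j \<omega> \<le> - c * sqrt n)) < real n}"
    let ?C = "{\<omega>. 1 - 2 / real (Suc K) \<le> freq (\<lambda>j. 0 < W j \<omega>) (Suc K * n)}"
    have "{\<omega> \<in> space S. c * sqrt n < W n \<omega>} \<in> sets S" by measurable
    moreover have "{\<omega> \<in> space S. (\<Sum>j<K * n. of_bool (W j \<omega> \<le> - c * sqrt n)) < real n} \<in> sets S"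
      by measurable
    moreover have "{\<omega> \<in> space S. 1 - 2 / real (Suc K) \<le> freq (\<lambda>j. 0 < W j \<omega>) (Suc K * n)} \<in> sets S"
      unfolding freq_def by measurable
    ultimately have meas: "?A \<in> sets S" "?B \<in> sets S" "?C \<in> sets S" by simp_all
    have "\<delta> / 2 = \<delta> * (1 / 2)" by simp
    also have "\<dots> \<le> P.prob ?A * P.prob ?B"
      using elim \<delta> prob_few_returns[OF _ c, of n] by (intro mult_mono) auto
    also have "\<dots> \<le> P.prob ?C"
    proof (rule prob_comb_seq_ge[OF meas, of n])
      fix \<omega> \<omega>' assume \<omega>: "\<omega> \<in> ?A" "\<omega>' \<in> ?B"
      let ?w = "comb_seq n \<omega> \<omega>'"
      have W: "W (n + j) ?w = W n \<omega> + W j \<omega>'" for j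
        by (simp add: W_def walk_comb_seq)
      have "real (K * n) = (\<Sum>j<K * n. 1)" by simp
      also have "\<dots> \<le> (\<Sum>j<K * n. of_bool (0 < W (n + j) ?w) + of_bool (W j \<omega>' \<le> - c * sqrt n))"
        using \<omega>(1) by (intro sum_mono) (auto simp: W)
      also have "\<dots> = (\<Sum>j<K * n. of_bool (0 < W (n + j) ?w)) + (\<Sum>j<K * n. of_bool (W j \<omega>' \<le> - c * sqrt n))"
        by (rule sum.distrib)
      also have "\<dots> < (\<Sum>j<n. of_bool (0 < W j ?w)) + (\<Sum>j<K * n. of_bool (0 < W (n + j) ?w)) + real n"
        using \<omega>(2) sum_nonneg[of "{..<n}" "\<lambda>j. of_bool (0 < W j ?w) :: real"]
        by (auto simp del: sum_of_bool_eq)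
      also have "(\<Sum>j<n. of_bool (0 < W j ?w)) + (\<Sum>j<K * n. of_bool (0 < W (n + j) ?w))
          = (\<Sum>j<Suc K * n. of_bool (0 < W j ?w) :: real)"
        unfolding mult_Suc sum_lessThan_add ..
      finally have "real (K * n) - real n \<le> (\<Sum>j<Suc K * n. of_bool (0 < W j ?w))"
        by linarith
      then have "(real (K * n) - real n) / real (Suc K * n) \<le> freq (\<lambda>j. 0 < W j ?w) (Suc K * n)"
        unfolding freq_def by (rule divide_right_mono) simp
      moreover have "(real (K * n) - real n) / real (Suc K * n) = 1 - 2 / real (Suc K)"
      proof -
        have "real (K * n) - real n = (real K - 1) * real n" "real (Suc K * n) = (real K + 1) * real n"
          by (simp_all add: algebra_simps)
        then have "(real (K * n) - real n) / real (Suc K * n) = (real K - 1) / (real K + 1)"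
          using elim by simp
        then show ?thesis by (simp add: field_simps)
      qed
      ultimately show "?w \<in> ?C" by simp
    qed
    finally show ?case .
  qed
  then show ?thesis using \<delta>(1) by (intro exI[of _ "\<delta> / 2"]) simp
qed

text \<open>
  The probabilities of the events of \<open>eventually_mostly_positive\<close> do not tend to 0, so infinitely many of
  them occur with positive probability. The resulting event about the upper limit is almost surely
  unchanged when a finite word is prepended, and the zero-one law applies.
\<close>
lemma AE_limsup_ge:
  "AE \<omega> in S. ereal (1 - 2 / real (Suc K)) \<le> limsup (\<lambda>n. ereal (freq (\<lambda>j. 0 < walk \<zeta> \<omega> j) n))"
proof -
  let ?L = "\<lambda>\<omega>. limsup (\<lambda>n. ereal (freq (\<lambda>j. 0 < walk \<zeta> \<omega> j) n))"
  let ?r = "1 - 2 / real (Suc K)"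
  define C where "C = {\<omega>. ereal ?r \<le> ?L \<omega>}"
  have walk_W: "0 < walk \<zeta> \<omega> j \<longleftrightarrow> 0 < W j \<omega>" for \<omega> j
    by (simp add: W_def)
  have "{\<omega> \<in> space S. ereal ?r \<le> ?L \<omega>} \<in> sets S"
    unfolding freq_def walk_W by measurable
  then have C: "C \<in> sets S" by (simp add: C_def)
  obtain \<delta> where \<delta>: "0 < \<delta>" "\<forall>\<^sub>F n in sequentially. \<delta> \<le>
      P.prob {\<omega>. ?r \<le> freq (\<lambda>j. 0 < W j \<omega>) (Suc K * n)}"
    using eventually_mostly_positive by blast
  define G where "G n = {\<omega>. ?r \<le> freq (\<lambda>j. 0 < W j \<omega>) (Suc K * n)}" for n
  have "{\<omega> \<in> space S. ?r \<le> freq (\<lambda>j. 0 < W j \<omega>) (Suc K * n)} \<in> sets S" for n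
    unfolding freq_def by measurable
  then have G [measurable]: "G n \<in> sets S" for n by (simp add: G_def)
  have "P.prob C \<noteq> 0"
  proof -
    have "(\<lambda>m. P.prob (\<Union>n\<in>{m..}. G n)) \<longlonglongrightarrow> P.prob (\<Inter>m. \<Union>n\<in>{m..}. G n)"
    proof (rule P.finite_Lim_measure_decseq)
      show "decseq (\<lambda>m. \<Union>n\<in>{m..}. G n)"
        unfolding decseq_def by (intro allI impI UN_mono) auto
    qed auto
    moreover have "\<forall>\<^sub>F m in sequentially. \<delta> \<le> P.prob (\<Union>n\<in>{m..}. G n)"
      using \<delta>(2)
    proof eventually_elim
      case (elim m)
      also have "P.prob {\<omega>. ?r \<le> freq (\<lambda>j. 0 < W j \<omega>) (Suc K * m)} \<le> P.prob (\<Union>n\<in>{m..}. G n)"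
        unfolding G_def[symmetric] by (rule P.finite_measure_mono) auto
      finally show ?case .
    qed
    ultimately have "\<delta> \<le> P.prob (\<Inter>m. \<Union>n\<in>{m..}. G n)"
      by (intro tendsto_lowerbound) auto
    also have "\<dots> \<le> P.prob C"
    proof (rule P.finite_measure_mono[OF _ C], rule subsetI)
      fix \<omega> assume "\<omega> \<in> (\<Inter>m. \<Union>n\<in>{m..}. G n)"
      then have inf: "\<exists>n\<ge>m. ?r \<le> freq (\<lambda>j. 0 < walk \<zeta> \<omega> j) (Suc K * n)" for m
        by (auto simp: G_def walk_W)
      have "ereal ?r \<le> (SUP n\<in>{m..}. ereal (freq (\<lambda>j. 0 < walk \<zeta> \<omega> j) n))" for m
      proof -
        obtain n where n: "n \<ge> m" "?r \<le> freq (\<lambda>j. 0 < walk \<zeta> \<omega> j) (Suc K * n)"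
          using inf by blast
        have "Suc K * n \<ge> m" using n(1) by simp
        then show ?thesis using n(2) by (intro SUP_upper2[of "Suc K * n"]) auto
      qed
      then show "\<omega> \<in> C" by (simp add: C_def limsup_INF_SUP INF_greatest)
    qed
    finally show ?thesis using \<delta>(1) by simp
  qed
  then have "P.prob C = 1"
  proof (rule zero_one_law[OF C, rotated])
    fix m
    show "AE \<omega>' in S. \<forall>\<omega>. comb_seq m \<omega> \<omega>' \<in> C \<longleftrightarrow> \<omega>' \<in> C"
      using AE_freq_bounded
    proof eventually_elim
      case (elim \<omega>')
      have "?L (comb_seq m \<omega> \<omega>') = ?L \<omega>'" for \<omega>
      proof -
        let ?u = "freq (\<lambda>j. 0 < walk \<zeta> (comb_seq m \<omega> \<omega>') j)" and ?v = "freq (\<lambda>j. 0 < walk \<zeta> \<omega>' j)"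
        have "(\<lambda>n. ?u n - ?v n) \<longlonglongrightarrow> 0"
          using elim by (intro freq_positive_shift[where s = "walk \<zeta> \<omega> m" and m = m] walk_comb_seq) blast
        then have "(\<lambda>n. ereal (?u n - ?v n)) \<longlonglongrightarrow> 0" by (simp add: zero_ereal_def)
        then have "limsup (\<lambda>n. ereal (?u n - ?v n) + ereal (?v n)) = 0 + limsup (\<lambda>n. ereal (?v n))"
          by (rule ereal_limsup_lim_add) simp
        then show ?thesis by simp
      qed
      then show ?case by (simp add: C_def)
    qed
  qed
  then have "AE \<omega> in S. \<omega> \<in> C" by (simp add: P.prob_eq_1 C)
  then show ?thesis by (simp add: C_def)
qed

lemma AE_frequently_mostly_positive:
  "AE \<omega> in S. \<forall>e>0. \<exists>\<^sub>F n in sequentially. 1 - e < freq (\<lambda>j. 0 < walk \<zeta> \<omega> j) n"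
proof -
  have "AE \<omega> in S. \<forall>K. ereal (1 - 2 / real (Suc K)) \<le> limsup (\<lambda>n. ereal (freq (\<lambda>j. 0 < walk \<zeta> \<omega> j) n))"
    by (subst AE_all_countable) (simp add: AE_limsup_ge del: of_nat_Suc)
  then show ?thesis
  proof eventually_elim
    case (elim \<omega>)
    show ?case
    proof (intro allI impI)
      fix e :: real assume "0 < e"
      obtain K where "2 / e < real K" using reals_Archimedean2 by blast
      then have "2 / real (Suc K) < e" using \<open>0 < e\<close> by (simp add: field_simps)
      then have "ereal (1 - e) < ereal (1 - 2 / real (Suc K))" by simp
      also have "\<dots> \<le> limsup (\<lambda>n. ereal (freq (\<lambda>j. 0 < walk \<zeta> \<omega> j) n))" using elim by blast
      finally show "\<exists>\<^sub>F n in sequentially. 1 - e < freq (\<lambda>j. 0 < walk \<zeta> \<omega> j) n"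
        using Limsup_bounded[of "\<lambda>n. ereal (freq (\<lambda>j. 0 < walk \<zeta> \<omega> j) n)" "ereal (1 - e)" sequentially]
        by (auto simp: frequently_def not_less)
    qed
  qed
qed

end

lemma (in centered_walk) centered_walk_uminus: "centered_walk p (\<lambda>a. - \<zeta> a)"
  by unfold_locales (use square_integrable mean variance_pos in simp_all)

lemma (in centered_walk) AE_oscillating: "AE \<omega> in S. oscillating (walk \<zeta> \<omega>)"
proof -
  interpret neg: centered_walk p "\<lambda>a. - \<zeta> a" by (rule centered_walk_uminus)
  show ?thesis
    using AE_freq_bounded AE_frequently_mostly_positive neg.AE_frequently_mostly_positive
    by eventually_elim (simp add: oscillating_def walk_uminus)
qed

section \<open>Limit measures carried by the endpoints\<close>

lemma sets_empirical_measure [simp]: "sets (empirical_measure f \<omega> x n) = sets unit_borel"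
  by (simp add: empirical_measure_def)

lemma sets_convex_combination [simp]: "sets (convex_combination l \<mu> \<nu>) = sets unit_borel"
  by (simp add: convex_combination_def)

lemma space_unit_borel [simp]: "space unit_borel = {0..1}"
  by (simp add: unit_borel_def space_restrict_space)

lemma continuous_on_measurable_unit_borel:
  "continuous_on {0..1} \<phi> \<Longrightarrow> (\<phi> :: real \<Rightarrow> real) \<in> borel_measurable unit_borel"
  unfolding unit_borel_def by (rule borel_measurable_continuous_on_restrict)

lemma empirical_measure_eq_distr:
  assumes n: "0 < n" and orbit: "\<And>j. fiber_iter f \<omega> j x \<in> {0..1}"
  shows "empirical_measure f \<omega> x n =
    distr (measure_pmf (pmf_of_set {..<n})) unit_borel (\<lambda>j. fiber_iter f \<omega> j x)"
proof (rule measure_eqI)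
  fix A assume "A \<in> sets (empirical_measure f \<omega> x n)"
  then have A: "A \<in> sets unit_borel" by simp
  let ?y = "\<lambda>j. fiber_iter f \<omega> j x"
  have meas: "?y \<in> measure_pmf (pmf_of_set {..<n}) \<rightarrow>\<^sub>M unit_borel"
    using orbit by (auto simp: measurable_def)
  have ne: "{..<n} \<noteq> {}" using n by auto
  have "emeasure (empirical_measure f \<omega> x n) A = ennreal (1 / real n) * (\<Sum>j<n. indicator A (?y j))"
    using A by (simp add: emeasure_empirical_measure)
  also have "(\<Sum>j<n. indicator A (?y j) :: ennreal) = ennreal (\<Sum>j<n. indicator A (?y j))"
    by (simp add: ennreal_indicator flip: sum_ennreal)
  also have "(\<Sum>j<n. indicator A (?y j) :: real) = real (card ({..<n} \<inter> ?y -` A))"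
    by (simp add: indicator_def Int_def flip: of_bool_def)
  also have "ennreal (1 / real n) * ennreal (real (card ({..<n} \<inter> ?y -` A)))
      = ennreal (real (card ({..<n} \<inter> ?y -` A)) / real n)"
    by (simp add: ennreal_mult'[symmetric])
  also have "\<dots> = emeasure (distr (measure_pmf (pmf_of_set {..<n})) unit_borel ?y) A"
    using ne A meas by (simp add: emeasure_distr emeasure_pmf_of_set)
  finally show "emeasure (empirical_measure f \<omega> x n) A = \<dots>" .
qed simp

lemma empirical_measure_in_unit_prob_measures:
  assumes "0 < n" "\<And>j. fiber_iter f \<omega> j x \<in> {0..1}"
  shows "empirical_measure f \<omega> x n \<in> unit_prob_measures"
  unfolding empirical_measure_eq_distr[OF assms] unit_prob_measures_def
  using assms by (auto intro!: prob_space.prob_space_distr prob_space_measure_pmf simp: measurable_def)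

lemma integral_empirical_measure:
  fixes \<phi> :: "real \<Rightarrow> real"
  assumes "0 < n" "\<And>j. fiber_iter f \<omega> j x \<in> {0..1}" and \<phi>: "\<phi> \<in> borel_measurable unit_borel"
  shows "(\<integral>x. \<phi> x \<partial>empirical_measure f \<omega> x n) = 1 / real n * (\<Sum>j<n. \<phi> (fiber_iter f \<omega> j x))"
proof -
  have ne: "{..<n} \<noteq> {}" using assms by auto
  show ?thesis
    unfolding empirical_measure_eq_distr[OF assms(1,2)]
    using assms(2) \<phi> by (subst integral_distr) (auto simp: measurable_def integral_pmf_of_set[OF ne])
qed

abbreviation endpoint_mixture :: "real \<Rightarrow> real measure" where
  "endpoint_mixture l \<equiv> convex_combination l (return unit_borel 0) (return unit_borel 1)"

lemma endpoint_mixture_eq_distr: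
  assumes l: "0 \<le> l" "l \<le> 1"
  shows "endpoint_mixture l =
    distr (measure_pmf (bernoulli_pmf l)) unit_borel (\<lambda>b. if b then 0 else 1)"
proof (rule measure_eqI)
  fix A assume "A \<in> sets (endpoint_mixture l)"
  then have A: "A \<in> sets unit_borel" by simp
  have meas: "(\<lambda>b. if b then 0 else 1) \<in> measure_pmf (bernoulli_pmf l) \<rightarrow>\<^sub>M unit_borel"
    by (auto simp: measurable_def)
  have "emeasure (distr (measure_pmf (bernoulli_pmf l)) unit_borel (\<lambda>b. if b then 0 else 1)) A
      = (\<integral>\<^sup>+b. indicator A (if b then 0 else 1 :: real) \<partial>measure_pmf (bernoulli_pmf l))"
    using A by (subst nn_integral_indicator[symmetric], simp, subst nn_integral_distr[OF meas])
      simp_all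
  also have "\<dots> = ennreal l * indicator A 0 + ennreal (1 - l) * indicator A 1"
    using l by (simp add: nn_integral_bernoulli_pmf mult.commute)
  finally show "emeasure (endpoint_mixture l) A =
      emeasure (distr (measure_pmf (bernoulli_pmf l)) unit_borel (\<lambda>b. if b then 0 else 1)) A"
    using A by (simp add: emeasure_convex_combination)
qed simp

lemma endpoint_mixture_in_unit_prob_measures:
  "0 \<le> l \<Longrightarrow> l \<le> 1 \<Longrightarrow> endpoint_mixture l \<in> unit_prob_measures"
  unfolding endpoint_mixture_eq_distr unit_prob_measures_def
  by (auto intro!: prob_space.prob_space_distr prob_space_measure_pmf simp: measurable_def)

lemma integral_endpoint_mixture:
  fixes \<phi> :: "real \<Rightarrow> real"
  assumes l: "0 \<le> l" "l \<le> 1" and \<phi>: "\<phi> \<in> borel_measurable unit_borel"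
  shows "(\<integral>x. \<phi> x \<partial>endpoint_mixture l) = l * \<phi> 0 + (1 - l) * \<phi> 1"
  unfolding endpoint_mixture_eq_distr[OF l]
  using l \<phi> by (subst integral_distr) (auto simp: measurable_def)

text \<open>A measure carried by two points is determined by its mass at one of them.\<close>
lemma eq_endpoint_mixture_if_AE:
  assumes \<mu>: "\<mu> \<in> unit_prob_measures" and AE: "AE x in \<mu>. x = 0 \<or> x = 1"
  shows "\<exists>l\<in>{0..1}. \<mu> = endpoint_mixture l"
proof -
  interpret prob_space \<mu> using \<mu> by (simp add: unit_prob_measures_def)
  have sets: "sets \<mu> = sets unit_borel" using \<mu> by (simp add: unit_prob_measures_def)
  have singleton: "{0} \<in> sets \<mu>" "{1} \<in> sets \<mu>"
    unfolding sets unit_borel_def by (auto simp: sets_restrict_space image_iff intro!: bexI[of _ "{_}"])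
  define l where "l = measure \<mu> {0}"
  have split: "emeasure \<mu> A = emeasure \<mu> {0} * indicator A 0 + emeasure \<mu> {1} * indicator A 1"
    if A: "A \<in> sets \<mu>" for A
  proof -
    have "emeasure \<mu> A = emeasure \<mu> ((A \<inter> {0}) \<union> (A \<inter> {1}))"
      using AE A singleton by (intro emeasure_eq_AE) auto
    also have "\<dots> = emeasure \<mu> (A \<inter> {0}) + emeasure \<mu> (A \<inter> {1})"
      using A singleton by (intro plus_emeasure[symmetric]) auto
    also have "\<dots> = emeasure \<mu> {0} * indicator A 0 + emeasure \<mu> {1} * indicator A 1"
      by (auto simp: indicator_def)
    finally show ?thesis .
  qed
  have sp: "space \<mu> = {0..1}" using sets_eq_imp_space_eq[OF sets] by simp
  have "1 = emeasure \<mu> {0} + emeasure \<mu> {1}"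
    using split[OF sets.top] emeasure_space_1 by (simp add: sp)
  then have "measure \<mu> {1} = 1 - l"
    by (simp add: l_def emeasure_eq_measure ennreal_plus[symmetric] del: ennreal_plus)
  then have one: "emeasure \<mu> {1} = ennreal (1 - l)" and zero: "emeasure \<mu> {0} = ennreal l"
    by (simp_all add: l_def emeasure_eq_measure)
  have "\<mu> = endpoint_mixture l"
  proof (rule measure_eqI)
    show "sets \<mu> = sets (endpoint_mixture l)" by (simp add: sets)
    fix A assume "A \<in> sets \<mu>"
    then show "emeasure \<mu> A = emeasure (endpoint_mixture l) A"
      using split[of A] by (simp add: emeasure_convex_combination sets one zero)
  qed
  moreover have "l \<in> {0..1}" by (simp add: l_def)
  ultimately show ?thesis by blast
qed

text \<open>
  If all averages along the orbit are asymptotically those of the mixture with weight \<open>a n\<close> at 1, then the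
  limit measures are the mixtures whose weights are cluster points of \<open>a\<close>. For one inclusion, test with
  \<open>\<phi> y = y * (1 - y)\<close>: its averages tend to 0, so a limit measure is carried by the endpoints. For the
  other, the empirical measures converge along a filter on which \<open>a\<close> converges.
\<close>
lemma limit_measures_eq_endpoint_mixtures:
  fixes f :: "'a \<Rightarrow> real \<Rightarrow> real" and a :: "nat \<Rightarrow> real"
  assumes orbit: "\<And>j. fiber_iter f \<omega> j x \<in> {0..1}"
    and avg: "\<And>\<phi> :: real \<Rightarrow> real. continuous_on {0..1} \<phi> \<Longrightarrow>
      (\<lambda>n. 1 / real n * (\<Sum>j<n. \<phi> (fiber_iter f \<omega> j x)) - ((1 - a n) * \<phi> 0 + a n * \<phi> 1)) \<longlonglongrightarrow> 0"
    and cluster: "\<And>l e. 0 \<le> l \<Longrightarrow> l \<le> 1 \<Longrightarrow> 0 < e \<Longrightarrow> \<exists>\<^sub>F n in sequentially. \<bar>a n - l\<bar> < e"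
  shows "limit_measures f \<omega> x = {endpoint_mixture l | l. l \<in> {0..1}}"
proof (intro equalityI subsetI)
  fix \<mu> assume "\<mu> \<in> {endpoint_mixture l | l. l \<in> {0..1}}"
  then obtain l where l: "0 \<le> l" "l \<le> 1" and \<mu>: "\<mu> = endpoint_mixture l" by auto
  \<comment> \<open>The filter plays the part of a subsequence along which \<open>a\<close> tends to the mass \<open>1 - l\<close> at the right endpoint.\<close>
  define F where "F = inf sequentially (filtercomap a (nhds (1 - l)))"
  have F_le: "F \<le> sequentially" by (simp add: F_def)
  have "F \<noteq> bot"
  proof
    assume "F = bot"
    then have "eventually (\<lambda>_. False) F" by simp
    then obtain Q R where "eventually Q sequentially" "eventually R (filtercomap a (nhds (1 - l)))"
      and QR: "\<And>n. Q n \<Longrightarrow> R n \<Longrightarrow> False"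
      unfolding F_def eventually_inf by blast
    then obtain e where "0 < e" and R: "\<And>n. dist (a n) (1 - l) < e \<Longrightarrow> R n"
      unfolding eventually_filtercomap eventually_nhds_metric by blast
    have "\<exists>\<^sub>F n in sequentially. \<bar>a n - (1 - l)\<bar> < e"
      using cluster l \<open>0 < e\<close> by simp
    then have "\<exists>\<^sub>F n in sequentially. Q n \<and> \<bar>a n - (1 - l)\<bar> < e"
      using \<open>eventually Q sequentially\<close> by (rule frequently_eventually_conj)
    then obtain n where "\<bar>a n - (1 - l)\<bar> < e" "Q n" by (auto dest: frequently_ex)
    then show False using QR[of n] R[of n] by (simp add: dist_real_def)
  qed
  have a_lim: "(a \<longlongrightarrow> 1 - l) F"
    unfolding F_def filterlim_def by (intro order_trans[OF filtermap_mono[OF inf.cobounded2]] filtermap_filtercomap)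
  have pos: "\<forall>\<^sub>F n in F. 0 < n"
    by (rule filter_leD[OF F_le eventually_gt_at_top])
  have int_lim: "((\<lambda>n. \<integral>y. \<phi> y \<partial>empirical_measure f \<omega> x n) \<longlongrightarrow> (\<integral>y. \<phi> y \<partial>\<mu>)) F"
    if \<phi>: "continuous_on {0..1} \<phi>" for \<phi> :: "real \<Rightarrow> real"
  proof -
    note m = continuous_on_measurable_unit_borel[OF \<phi>]
    have "((\<lambda>n. (1 / real n * (\<Sum>j<n. \<phi> (fiber_iter f \<omega> j x)) - ((1 - a n) * \<phi> 0 + a n * \<phi> 1))
        + ((1 - a n) * \<phi> 0 + a n * \<phi> 1)) \<longlongrightarrow> 0 + ((1 - (1 - l)) * \<phi> 0 + (1 - l) * \<phi> 1)) F"
      by (intro tendsto_intros a_lim tendsto_mono[OF F_le avg[OF \<phi>]])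
    then have "((\<lambda>n. 1 / real n * (\<Sum>j<n. \<phi> (fiber_iter f \<omega> j x))) \<longlongrightarrow> (\<integral>y. \<phi> y \<partial>\<mu>)) F"
      by (simp add: \<mu> integral_endpoint_mixture[OF l m])
    then show ?thesis
    proof (rule Lim_transform_eventually)
      show "\<forall>\<^sub>F n in F. 1 / real n * (\<Sum>j<n. \<phi> (fiber_iter f \<omega> j x)) =
          (\<integral>y. \<phi> y \<partial>empirical_measure f \<omega> x n)"
        using pos by eventually_elim (rule integral_empirical_measure[OF _ orbit m, symmetric])
    qed
  qed
  have "\<forall>\<^sub>F n in F. empirical_measure f \<omega> x n \<in> U"
    if "openin weak_star_topology U" "\<mu> \<in> U" for U
  proof -
    let ?B = "{{\<mu> \<in> unit_prob_measures. (\<integral>x. \<phi> x \<partial>\<mu>) \<in> U} | \<phi> U.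
        continuous_on {0..1} (\<phi> :: real \<Rightarrow> real) \<and> open (U :: real set)}"
    have "generate_topology_on ?B U"
      using that(1) unfolding weak_star_topology_def openin_topology_generated_by_iff .
    then show ?thesis using that(2)
    proof induction
      case Empty
      then show ?case by simp
    next
      case (Int A B)
      then show ?case by (auto intro: eventually_conj)
    next
      case (UN K)
      then obtain A where A: "A \<in> K" "\<mu> \<in> A" by blast
      show ?case using UN.IH[OF A] by eventually_elim (use A in blast)
    next
      case (Basis A)
      from Basis.hyps have "\<exists>\<phi> O'. A = {\<mu> \<in> unit_prob_measures. (\<integral>x. \<phi> x \<partial>\<mu>) \<in> O'} \<and>
          continuous_on {0..1} (\<phi> :: real \<Rightarrow> real) \<and> open (O' :: real set)"
        unfolding mem_Collect_eq .
      then obtain \<phi> :: "real \<Rightarrow> real" and O' :: "real set"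
        where A: "A = {\<mu> \<in> unit_prob_measures. (\<integral>x. \<phi> x \<partial>\<mu>) \<in> O'} \<and> continuous_on {0..1} \<phi> \<and> open O'"
        by (elim exE)
      note \<phi> = A[THEN conjunct2, THEN conjunct1] and O' = A[THEN conjunct2, THEN conjunct2]
      note A = A[THEN conjunct1]
      have "(\<integral>x. \<phi> x \<partial>\<mu>) \<in> O'" using Basis.prems unfolding A by blast
      then have "\<forall>\<^sub>F n in F. (\<integral>y. \<phi> y \<partial>empirical_measure f \<omega> x n) \<in> O'"
        by (rule topological_tendstoD[OF int_lim[OF \<phi>] O'])
      then show ?case
        using pos
      proof eventually_elim
        case (elim n)
        then show ?case
          using empirical_measure_in_unit_prob_measures[OF elim(2) orbit] unfolding A by blast
      qed
    qed
  qed
  then have "\<exists>\<^sub>F n in sequentially. empirical_measure f \<omega> x n \<in> U"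
    if "openin weak_star_topology U" "\<mu> \<in> U" for U
    using eventually_frequently[OF \<open>F \<noteq> bot\<close>] that filter_leD[OF F_le, of "\<lambda>n. empirical_measure f \<omega> x n \<notin> U"]
    by (auto simp: frequently_def)
  then show "\<mu> \<in> limit_measures f \<omega> x"
    using endpoint_mixture_in_unit_prob_measures[OF l]
    by (auto simp: limit_measures_def topspace_weak_star_topology \<mu>)
next
  fix \<mu> assume "\<mu> \<in> limit_measures f \<omega> x"
  then have \<mu>: "\<mu> \<in> unit_prob_measures"
    and freq: "\<And>U. openin weak_star_topology U \<Longrightarrow> \<mu> \<in> U \<Longrightarrow>
      \<exists>\<^sub>F n in sequentially. empirical_measure f \<omega> x n \<in> U"
    by (auto simp: limit_measures_def topspace_weak_star_topology)
  interpret prob_space \<mu> using \<mu> by (simp add: unit_prob_measures_def)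
  have sets: "sets \<mu> = sets unit_borel" using \<mu> by (simp add: unit_prob_measures_def)
  have sp: "space \<mu> = {0..1}" using sets_eq_imp_space_eq[OF sets] by simp
  define \<phi> :: "real \<Rightarrow> real" where "\<phi> y = y * (1 - y)" for y
  have \<phi>: "continuous_on {0..1} \<phi>" unfolding \<phi>_def by (intro continuous_intros)
  note m = continuous_on_measurable_unit_borel[OF \<phi>]
  have m\<mu>: "\<phi> \<in> borel_measurable \<mu>" using m measurable_cong_sets[OF sets refl] by blast
  have bounds: "0 \<le> \<phi> y" "\<phi> y \<le> 1" if "y \<in> {0..1}" for y
    using that mult_mono[of y 1 "1 - y" 1] by (auto simp: \<phi>_def)
  let ?c = "\<integral>y. \<phi> y \<partial>\<mu>"
  have lim0: "(\<lambda>n. 1 / real n * (\<Sum>j<n. \<phi> (fiber_iter f \<omega> j x))) \<longlonglongrightarrow> 0"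
    using avg[OF \<phi>] by (simp add: \<phi>_def)
  have "?c = 0"
  proof (rule ccontr)
    assume c: "?c \<noteq> 0"
    let ?U = "{\<mu> \<in> unit_prob_measures. (\<integral>x. \<phi> x \<partial>\<mu>) \<in> ball ?c (\<bar>?c\<bar> / 2)}"
    have "openin weak_star_topology ?U"
      unfolding weak_star_topology_def by (rule topology_generated_by_Basis) (use \<phi> in blast)
    then have "\<exists>\<^sub>F n in sequentially. empirical_measure f \<omega> x n \<in> ?U"
      using \<mu> c by (intro freq) auto
    moreover have "\<forall>\<^sub>F n in sequentially. \<bar>1 / real n * (\<Sum>j<n. \<phi> (fiber_iter f \<omega> j x))\<bar> < \<bar>?c\<bar> / 2 \<and> 0 < n"
      using tendstoD[OF lim0, of "\<bar>?c\<bar> / 2"] c eventually_gt_at_top[of "0::nat"]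
      by (intro eventually_conj) (auto simp: dist_real_def)
    ultimately have "\<exists>\<^sub>F n in sequentially. (\<bar>1 / real n * (\<Sum>j<n. \<phi> (fiber_iter f \<omega> j x))\<bar> < \<bar>?c\<bar> / 2
        \<and> 0 < n) \<and> empirical_measure f \<omega> x n \<in> ?U"
      by (rule frequently_eventually_conj)
    then obtain n where n: "empirical_measure f \<omega> x n \<in> ?U" "0 < n"
      "\<bar>1 / real n * (\<Sum>j<n. \<phi> (fiber_iter f \<omega> j x))\<bar> < \<bar>?c\<bar> / 2"
      by (auto dest: frequently_ex)
    then have "\<bar>?c - 1 / real n * (\<Sum>j<n. \<phi> (fiber_iter f \<omega> j x))\<bar> < \<bar>?c\<bar> / 2"
      using integral_empirical_measure[OF n(2) orbit m] by (simp add: dist_real_def)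
    then show False using n(3) by linarith
  qed
  moreover have "integrable \<mu> \<phi>"
    using bounds by (intro integrable_const_bound[where B = 1] m\<mu>) (auto simp: sp)
  moreover have "AE y in \<mu>. 0 \<le> \<phi> y" using bounds by (auto simp: sp)
  ultimately have "AE y in \<mu>. \<phi> y = 0"
    using integral_nonneg_eq_0_iff_AE by blast
  then have "AE y in \<mu>. y = 0 \<or> y = 1" by (simp add: \<phi>_def)
  then show "\<mu> \<in> {endpoint_mixture l | l. l \<in> {0..1}}"
    using eq_endpoint_mixture_if_AE[OF \<mu>] by blast
qed

section \<open>Fiber maps that follow a walk on the intervals\<close>

text \<open>
  A bijection that fixes 1 preserves the half-open interval \<open>[0, 1)\<close>, and so does its inverse. This is why
  no point leaves \<open>[q k, q (k + 1))\<close> through the right end.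
\<close>
lemma homeomorphism_fixes_1:
  assumes "homeomorphism {0..1} {0..1} T S" "{x \<in> {0..1}. T x = x} = {0, 1::real}"
  shows "bij_betw T {0..1} {0..1} \<and> T 1 = 1"
proof
  show "bij_betw T {0..1} {0..1}"
    using assms(1) unfolding homeomorphism_def bij_betw_def
    by (metis inj_on_inverseI)
  show "T 1 = 1" using assms(2) by auto
qed

lemma int_iterate_half_open:
  assumes T: "bij_betw T {0..1} {0..1}" "T 1 = 1" and u: "u \<in> {0..<1::real}"
  shows "int_iterate T m u \<in> {0..<1}"
proof -
  have half: "(g ^^ n) u \<in> {0..<1}" if g: "bij_betw g {0..1} {0..1}" "g 1 = 1" for g :: "real \<Rightarrow> real" and n
  proof (induction n)
    case 0
    then show ?case using u by simp
  next
    case (Suc n)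
    let ?v = "(g ^^ n) u"
    have v: "?v \<in> {0..1}" "?v \<noteq> 1" using Suc by auto
    have "g ?v \<in> {0..1}" using g(1) v(1) by (auto simp: bij_betw_def)
    moreover have "g ?v \<noteq> 1"
    proof
      assume "g ?v = 1"
      then have "g ?v = g 1" using g(2) by simp
      then have "?v = 1"
        using g(1) v(1) by (meson atLeastAtMost_iff bij_betw_imp_inj_on inj_onD order_refl zero_le_one)
      then show False using v(2) by simp
    qed
    ultimately show ?case by auto
  qed
  have "inv_into {0..1} T 1 = 1"
    using T by (metis atLeastAtMost_iff bij_betw_inv_into_left order_refl zero_le_one)
  then show ?thesis
    unfolding int_iterate_def using half[OF T] half[OF bij_betw_inv_into[OF T(1)]] by auto
qed

locale interval_partition =
  fixes q :: "int \<Rightarrow> real"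
  assumes q: "range q \<subseteq> {0<..<1}" "strict_mono q" "(q \<longlongrightarrow> 0) at_bot" "(q \<longlongrightarrow> 1) at_top"
begin

lemma in_open_unit_interval:
  assumes "x \<in> {q k..<q (k + 1)}"
  shows "0 < x \<and> x < 1"
proof -
  have "q k \<in> {0<..<1}" "q (k + 1) \<in> {0<..<1}" using q(1) by blast+
  then show ?thesis using assms by auto
qed

text \<open>
  Off a window \<open>\<bar>w j\<bar> \<le> M\<close> the value \<open>\<phi> (y j)\<close> is close to \<open>\<phi> 1\<close> or \<open>\<phi> 0\<close>, according to the sign of \<open>w j\<close>,
  by continuity at the endpoints. The window is visited with frequency 0 and \<open>\<phi>\<close> is bounded.
\<close>
lemma average_near_endpoints:
  fixes \<phi> :: "real \<Rightarrow> real" and w :: "nat \<Rightarrow> int"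
  assumes y: "\<And>j. y j \<in> {q (k + w j)..<q (k + w j + 1)}"
    and escape: "\<And>M. freq (\<lambda>j. \<bar>w j\<bar> \<le> M) \<longlonglongrightarrow> 0"
    and \<phi>: "continuous_on {0..1} \<phi>"
  shows "(\<lambda>n. 1 / real n * (\<Sum>j<n. \<phi> (y j))
      - ((1 - freq (\<lambda>j. 0 < w j) n) * \<phi> 0 + freq (\<lambda>j. 0 < w j) n * \<phi> 1)) \<longlonglongrightarrow> 0"
proof -
  let ?a = "freq (\<lambda>j. 0 < w j)"
  define g where "g j = \<phi> (y j) - (if 0 < w j then \<phi> 1 else \<phi> 0)" for j
  have y01: "y j \<in> {0..1}" for j
    using in_open_unit_interval[OF y[of j]] by simp
  have "bounded (\<phi> ` {0..1})"
    by (intro compact_imp_bounded compact_continuous_image \<phi>) simp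
  then obtain C where "\<forall>x\<in>{0..1}. \<bar>\<phi> x\<bar> \<le> C"
    unfolding bounded_iff by auto
  then have C: "\<bar>\<phi> x\<bar> \<le> C" if "x \<in> {0..1}" for x using that by blast
  have g_le: "\<bar>g j\<bar> \<le> 2 * C" for j
    using C[OF y01[of j]] C[of 0] C[of 1] by (auto simp: g_def)
  have eq: "1 / real n * (\<Sum>j<n. \<phi> (y j)) - ((1 - ?a n) * \<phi> 0 + ?a n * \<phi> 1) = 1 / real n * (\<Sum>j<n. g j)"
    if "0 < n" for n
  proof -
    have "(if 0 < w j then \<phi> 1 else \<phi> 0) = of_bool (0 < w j) * (\<phi> 1 - \<phi> 0) + \<phi> 0" for j
      by simp
    then have "(\<Sum>j<n. g j) = (\<Sum>j<n. \<phi> (y j)) - ((\<Sum>j<n. of_bool (0 < w j)) * (\<phi> 1 - \<phi> 0) + n * \<phi> 0)"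
      by (simp add: g_def sum_subtractf sum.distrib sum_distrib_right del: sum_of_bool_eq)
    moreover have "(\<Sum>j<n. of_bool (0 < w j)) = n * ?a n"
      using that by (simp add: freq_def)
    ultimately show ?thesis using that by (simp add: field_simps)
  qed
  have "(\<lambda>n. 1 / real n * (\<Sum>j<n. g j)) \<longlonglongrightarrow> 0"
  proof (rule LIMSEQ_I)
    fix e :: real assume e: "0 < e"
    then have e2: "0 < e / 2" by simp
    obtain d1 where d1: "0 < d1" "\<And>x. x \<in> {0..1} \<Longrightarrow> dist x 1 < d1 \<Longrightarrow> dist (\<phi> x) (\<phi> 1) < e / 2"
      using \<phi> e2 unfolding continuous_on_iff by (metis atLeastAtMost_iff order_refl zero_le_one)
    obtain d0 where d0: "0 < d0" "\<And>x. x \<in> {0..1} \<Longrightarrow> dist x 0 < d0 \<Longrightarrow> dist (\<phi> x) (\<phi> 0) < e / 2"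
      using \<phi> e2 unfolding continuous_on_iff by (metis atLeastAtMost_iff order_refl zero_le_one)
    obtain k1 where k1: "\<And>i. i \<ge> k1 \<Longrightarrow> 1 - d1 < q i"
      using order_tendstoD(1)[OF q(4), of "1 - d1"] d1(1) by (auto simp: eventually_at_top_linorder)
    obtain k0 where k0: "\<And>i. i \<le> k0 \<Longrightarrow> q i < d0"
      using order_tendstoD(2)[OF q(3), of d0] d0(1) by (auto simp: eventually_at_bot_linorder)
    define M where "M = \<bar>k1\<bar> + \<bar>k0\<bar> + \<bar>k\<bar> + 1"
    have "\<bar>g j\<bar> \<le> e / 2" if "\<bar>w j\<bar> > M" for j
    proof (cases "0 < w j")
      case True
      then have "1 - d1 < q (k + w j)" using that by (intro k1) (simp add: M_def)
      then have "dist (y j) 1 < d1" using y[of j] y01[of j] by (auto simp: dist_real_def)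
      then show ?thesis using d1(2)[OF y01] True by (simp add: g_def dist_real_def less_imp_le)
    next
      case False
      then have "q (k + w j + 1) < d0" using that by (intro k0) (simp add: M_def)
      then have "dist (y j) 0 < d0" using y[of j] y01[of j] by (auto simp: dist_real_def)
      then show ?thesis using d0(2)[OF y01] False by (simp add: g_def dist_real_def less_imp_le)
    qed
    then have g2: "\<bar>g j\<bar> \<le> e / 2 + 2 * C * of_bool (\<bar>w j\<bar> \<le> M)" for j
      using g_le[of j] e by (cases "\<bar>w j\<bar> \<le> M") (auto simp: not_le intro: order_trans)
    have "(\<lambda>n. 2 * C * freq (\<lambda>j. \<bar>w j\<bar> \<le> M) n) \<longlonglongrightarrow> 0"
      using escape by (rule tendsto_mult_right_zero)
    then have "\<forall>\<^sub>F n in sequentially. 2 * C * freq (\<lambda>j. \<bar>w j\<bar> \<le> M) n < e / 2"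
      using e2 by (rule order_tendstoD)
    then have "\<forall>\<^sub>F n in sequentially. norm (1 / real n * (\<Sum>j<n. g j) - 0) < e"
      using eventually_gt_at_top[of "0::nat"]
    proof eventually_elim
      case (elim n)
      have "\<bar>\<Sum>j<n. g j\<bar> \<le> (\<Sum>j<n. e / 2 + 2 * C * of_bool (\<bar>w j\<bar> \<le> M))"
        using g2 by (rule sum_abs[THEN order_trans, OF sum_mono])
      also have "\<dots> = real n * (e / 2 + 2 * C * freq (\<lambda>j. \<bar>w j\<bar> \<le> M) n)"
        using elim(2)
        by (simp add: freq_def sum.distrib sum_distrib_left[symmetric] distrib_left del: sum_of_bool_eq)
      also have "\<dots> < real n * e"
        using elim by (intro mult_strict_left_mono) auto
      finally show ?case using elim(2) by (simp add: field_simps)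
    qed
    then show "\<exists>no. \<forall>n\<ge>no. norm (1 / real n * (\<Sum>j<n. g j) - 0) < e"
      by (simp add: eventually_sequentially)
  qed
  then show ?thesis
    by (rule Lim_transform_eventually)
      (use eventually_gt_at_top[of "0::nat"] in \<open>eventually_elim, simp only: eq\<close>)
qed

lemma interval_indexI:
  assumes x: "x \<in> {q k..<q (k + 1)}"
  shows "interval_index q x = k"
proof -
  have "0 < x" "x < 1" using in_open_unit_interval[OF x] by auto
  then show ?thesis
    unfolding interval_index_def using x interval_index_unique[OF q(2-4)]
    by (intro the1_equality) blast+
qed

text \<open>Powers of \<open>T\<close> preserve \<open>[0, 1)\<close>, so they move a point only within its new interval.\<close>
lemma walk_fiber_map_shifts_index:
  assumes T: "bij_betw T {0..1} {0..1}" "T 1 = 1"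
    and x: "x \<in> {q k..<q (k + 1)}"
  shows "walk_fiber_map q T \<psi> \<zeta> a x \<in> {q (k + \<zeta> a)..<q (k + \<zeta> a + 1)}"
proof -
  have x01: "0 < x" "x < 1" using in_open_unit_interval[OF x] by auto
  let ?u = "(x - q k) / (q (k + 1) - q k)" and ?l = "k + \<zeta> a"
  have d: "0 < q (i + 1) - q i" for i using q(2) by (simp add: strict_mono_def)
  have "?u \<in> {0..<1}" using x d[of k] by (auto simp: divide_less_eq)
  then have v: "int_iterate T (\<psi> a) ?u \<in> {0..<1}" by (rule int_iterate_half_open[OF T])
  have "walk_fiber_map q T \<psi> \<zeta> a x = q ?l + (q (?l + 1) - q ?l) * int_iterate T (\<psi> a) ?u"
    using x01 by (simp add: walk_fiber_map_def Let_def interval_indexI[OF x])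
  moreover have "(q (?l + 1) - q ?l) * int_iterate T (\<psi> a) ?u < (q (?l + 1) - q ?l) * 1"
    using v d[of ?l] by (intro mult_strict_left_mono) auto
  moreover have "0 \<le> (q (?l + 1) - q ?l) * int_iterate T (\<psi> a) ?u"
    using v d[of ?l] by (intro mult_nonneg_nonneg) auto
  ultimately show ?thesis by auto
qed

lemma fiber_iter_index:
  assumes T: "bij_betw T {0..1} {0..1}" "T 1 = 1"
    and x: "x \<in> {q k..<q (k + 1)}"
  shows "fiber_iter (walk_fiber_map q T \<psi> \<zeta>) \<omega> n x
    \<in> {q (k + walk \<zeta> \<omega> n)..<q (k + walk \<zeta> \<omega> n + 1)}"
proof (induction n)
  case 0
  then show ?case using x by simp
next
  case (Suc n)
  show ?case
    using walk_fiber_map_shifts_index[OF T Suc.IH, of \<psi> \<zeta> "\<omega> n"]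
    by (simp add: walk_Suc add.assoc)
qed

end

section \<open>Historical behavior of the skew product\<close>

theorem proposition6:
  fixes p :: "'a::countable pmf"
    and \<Psi> Z :: "(nat \<Rightarrow> 'a) \<Rightarrow> int"
    and \<psi> \<zeta> :: "'a \<Rightarrow> int"
    and T :: "real \<Rightarrow> real"
    and q :: "int \<Rightarrow> real"
  assumes full_support: "set_pmf p = UNIV"
    and one_step_\<Psi>: "\<And>\<omega>. \<Psi> \<omega> = \<psi> (\<omega> 0)"
    and one_step_Z: "\<And>\<omega>. Z \<omega> = \<zeta> (\<omega> 0)"
    and Z_integrable: "integrable (bernoulli_measure p) (\<lambda>\<omega>. real_of_int (Z \<omega>))"
    and Z_mean: "(\<integral>\<omega>. real_of_int (Z \<omega>) \<partial>bernoulli_measure p) = 0"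
    and Z_square_integrable: "integrable (bernoulli_measure p) (\<lambda>\<omega>. (real_of_int (Z \<omega>))\<^sup>2)"
    and Z_variance: "0 < (\<integral>\<omega>. (real_of_int (Z \<omega>))\<^sup>2 \<partial>bernoulli_measure p)"
    and T_homeomorphism: "\<exists>S. homeomorphism {0..1} {0..1} T S"
    and T_fixed_points: "{x \<in> {0..1}. T x = x} = {0, 1}"
    and q_range: "range q \<subseteq> {0<..<1}"
    and q_strict_mono: "strict_mono q"
    and q_at_bot: "(q \<longlongrightarrow> 0) at_bot"
    and q_at_top: "(q \<longlongrightarrow> 1) at_top"
  shows "historical_behavior_ae p (walk_fiber_map q T \<psi> \<zeta>) \<and>
    (\<forall>x\<in>{0<..<1}. AE \<omega> in bernoulli_measure p.
       limit_measures (walk_fiber_map q T \<psi> \<zeta>) \<omega> x =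
         {convex_combination l (return unit_borel 0) (return unit_borel 1) | l. l \<in> {0..1}})"
proof -
  let ?f = "walk_fiber_map q T \<psi> \<zeta>"
  interpret centered_walk p \<zeta>
  proof -
    interpret sequence_space "measure_pmf p" ..
    have c: "distr (bernoulli_measure p) (measure_pmf p) (\<lambda>\<omega>. \<omega> 0) = measure_pmf p"
      unfolding bernoulli_measure_def by (rule PiM_component) simp
    have m: "(\<lambda>\<omega>. \<omega> 0) \<in> bernoulli_measure p \<rightarrow>\<^sub>M measure_pmf p"
      unfolding bernoulli_measure_def by measurable
    have int: "integrable (measure_pmf p) g \<longleftrightarrow> integrable (bernoulli_measure p) (\<lambda>\<omega>. g (\<omega> 0))"
      "(\<integral>a. g a \<partial>measure_pmf p) = (\<integral>\<omega>. g (\<omega> 0) \<partial>bernoulli_measure p)" for g :: "'a \<Rightarrow> real"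
      using integrable_distr_eq[OF m, of g] integral_distr[OF m, of g] unfolding c by simp_all
    show "centered_walk p \<zeta>"
      by unfold_locales
        (use Z_mean Z_square_integrable Z_variance in \<open>simp_all add: int one_step_Z\<close>)
  qed
  interpret interval_partition q
    by unfold_locales (rule q_range q_strict_mono q_at_bot q_at_top)+
  obtain R where "homeomorphism {0..1} {0..1} T R" using T_homeomorphism by blast
  then have T: "bij_betw T {0..1} {0..1}" "T 1 = 1"
    using homeomorphism_fixes_1[OF _ T_fixed_points] by auto
  have orbit: "fiber_iter ?f \<omega> j x \<in> {q (k + walk \<zeta> \<omega> j)..<q (k + walk \<zeta> \<omega> j + 1)}"
    if "x \<in> {q k..<q (k + 1)}" for k x \<omega> j
    by (rule fiber_iter_index[OF T that])
  have avg: "(\<lambda>n. 1 / real n * (\<Sum>j<n. \<phi> (fiber_iter ?f \<omega> j x))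
      - ((1 - freq (\<lambda>j. 0 < walk \<zeta> \<omega> j) n) * \<phi> 0 + freq (\<lambda>j. 0 < walk \<zeta> \<omega> j) n * \<phi> 1)) \<longlonglongrightarrow> 0"
    if osc: "oscillating (walk \<zeta> \<omega>)" and x: "x \<in> {0<..<1}" and \<phi>: "continuous_on {0..1} \<phi>" for \<omega> x and \<phi> :: "real \<Rightarrow> real"
  proof -
    obtain k where "x \<in> {q k..<q (k + 1)}"
      using interval_index_unique[OF q(2-4)] x by (auto simp: Ex1_def)
    from average_near_endpoints[OF orbit[OF this] _ \<phi>] osc show ?thesis
      by (simp add: oscillating_def)
  qed
  have unit: "fiber_iter ?f \<omega> j x \<in> {0..1}" if x: "x \<in> {0<..<1}" for \<omega> j x
  proof -
    obtain k where "x \<in> {q k..<q (k + 1)}"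
      using interval_index_unique[OF q(2-4)] x by (auto simp: Ex1_def)
    then show ?thesis
      using in_open_unit_interval[OF orbit] by (simp add: less_imp_le)
  qed
  have limit: "limit_measures ?f \<omega> x = {endpoint_mixture l | l. l \<in> {0..1}}"
    if "oscillating (walk \<zeta> \<omega>)" "x \<in> {0<..<1}" for \<omega> x
    using limit_measures_eq_endpoint_mixtures[OF unit[OF that(2)] avg[OF that]
        oscillating_cluster_points[OF that(1)]] .
  \<comment> \<open>The identity is a witness: its averages are asymptotic to the fraction of positive times, which clusters at both 0 and 1.\<close>
  have historical: "\<not> convergent (\<lambda>n. 1 / real n * (\<Sum>j<n. fiber_iter ?f \<omega> j x))"
    if "oscillating (walk \<zeta> \<omega>)" "x \<in> {0<..<1}" for \<omega> x
  proof
    assume "convergent (\<lambda>n. 1 / real n * (\<Sum>j<n. fiber_iter ?f \<omega> j x))"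
    then obtain L where L: "(\<lambda>n. 1 / real n * (\<Sum>j<n. fiber_iter ?f \<omega> j x)) \<longlonglongrightarrow> L"
      by (auto simp: convergent_def)
    have "(\<lambda>n. 1 / real n * (\<Sum>j<n. fiber_iter ?f \<omega> j x) - freq (\<lambda>j. 0 < walk \<zeta> \<omega> j) n) \<longlonglongrightarrow> 0"
      using avg[OF that, of "\<lambda>x. x"] by simp
    from tendsto_diff[OF L this] have lim: "freq (\<lambda>j. 0 < walk \<zeta> \<omega> j) \<longlonglongrightarrow> L" by simp
    \<comment> \<open>A limit would be within \<open>1 / 4\<close> of both 0 and 1.\<close>
    have "\<bar>L - l\<bar> \<le> 1 / 4" if l: "0 \<le> l" "l \<le> 1" for l
    proof (rule ccontr)
      assume "\<not> ?thesis"
      then have "\<forall>\<^sub>F n in sequentially. 1 / 4 < \<bar>freq (\<lambda>j. 0 < walk \<zeta> \<omega> j) n - l\<bar>"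
        by (intro order_tendstoD(1)[OF tendsto_rabs[OF tendsto_diff[OF lim tendsto_const]]]) auto
      then have "\<not> (\<exists>\<^sub>F n in sequentially. \<bar>freq (\<lambda>j. 0 < walk \<zeta> \<omega> j) n - l\<bar> < 1 / 4)"
        unfolding not_frequently by eventually_elim simp
      moreover have "\<exists>\<^sub>F n in sequentially. \<bar>freq (\<lambda>j. 0 < walk \<zeta> \<omega> j) n - l\<bar> < 1 / 4"
        by (rule oscillating_cluster_points[OF \<open>oscillating (walk \<zeta> \<omega>)\<close> l]) simp
      ultimately show False by blast
    qed
    from this[of 0] this[of 1] show False by auto
  qed
  have osc: "AE \<omega> in bernoulli_measure p. oscillating (walk \<zeta> \<omega>)"
    unfolding bernoulli_measure_def by (rule AE_oscillating)
  have "historical_behavior_ae p ?f"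
    unfolding historical_behavior_ae_def
  proof -
    have unit_ae: "AE x in unit_lebesgue. x \<in> {0<..<1}"
    proof -
      have "AE x in lborel. x \<noteq> 0" "AE x in lborel. x \<noteq> (1::real)"
        by (rule AE_lborel_singleton)+
      then have "AE x in lborel. x \<in> {0..1} \<longrightarrow> x \<in> {0<..<1::real}"
        by eventually_elim auto
      then show ?thesis
        unfolding unit_lebesgue_def by (subst AE_restrict_space_iff) auto
    qed
    have sf: "sigma_finite_measure unit_lebesgue"
      unfolding unit_lebesgue_def by (rule sigma_finite_measure_restrict_space) (auto intro: lborel.sigma_finite_measure_axioms)
    interpret B: prob_space "bernoulli_measure p"
      unfolding bernoulli_measure_def by (rule P.prob_space_axioms)
    interpret U: sigma_finite_measure unit_lebesgue by (rule sf)
    interpret BU: pair_sigma_finite "bernoulli_measure p" unit_lebesgue ..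
    have "AE z in bernoulli_measure p \<Otimes>\<^sub>M unit_lebesgue. oscillating (walk \<zeta> (fst z))"
      by (rule BU.AE_pair_fst[OF osc])
    moreover have "AE z in bernoulli_measure p \<Otimes>\<^sub>M unit_lebesgue. snd z \<in> {0<..<1}"
      by (rule BU.AE_pair_snd[OF unit_ae])
    ultimately show "AE (\<omega>, x) in bernoulli_measure p \<Otimes>\<^sub>M unit_lebesgue.
        \<exists>\<phi>::real \<Rightarrow> real. continuous_on {0..1} \<phi> \<and>
          \<not> convergent (\<lambda>n. 1 / real n * (\<Sum>j<n. \<phi> (fiber_iter ?f \<omega> j x)))"
    proof eventually_elim
      case (elim z)
      then show ?case
        using historical[of "fst z" "snd z"] by (auto intro!: exI[of _ "\<lambda>x. x"] simp: case_prod_beta)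
    qed
  qed
  moreover have "\<forall>x\<in>{0<..<1}. AE \<omega> in bernoulli_measure p.
      limit_measures ?f \<omega> x = {endpoint_mixture l | l. l \<in> {0..1}}"
  proof
    fix x :: real assume x: "x \<in> {0<..<1}"
    show "AE \<omega> in bernoulli_measure p. limit_measures ?f \<omega> x = {endpoint_mixture l | l. l \<in> {0..1}}"
      using osc by eventually_elim (rule limit[OF _ x])
  qed
  ultimately show ?thesis by blast
qed

end
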